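(* Let $D$ be a connected, special, reduced, alternating diagram of an oriented knot or link, let $\Gamma=\Gamma(D)$ be its directed weighted Tait graph with Laplacian $L=L(\Gamma)$, let $\omega\in\{-1,+1\}$ be the common weight of all edges of $\Gamma$, and let $\widehat L=\omega L$ be the corresponding Laplacian with positive unit edge weights. For a directed edge $e$ of $\Gamma$ with initial vertex $v_i$ and terminal vertex $v_j$ put $$\rho(e)=(\widehat L^{+})_{ii}+(\widehat L^{+})_{jj}-2(\widehat L^{+})_{ij},\qquad r(e)=(L^{+})_{ii}+(L^{+})_{jj}-2(L^{+})_{ij}.$$ Then $$FP(D)=\frac12\sum_{e}\rho(e),$$ and equivalently $$FP(D)=\frac{\omega}{2}\sum_{e}r(e),$$ where both sums are over all directed edges of $\Gamma$ (counted with multiplicity).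
   Context: Diagrams. A diagram $D$ of an oriented (non-trivial) knot or link is a generic projection to the plane (a $4$-valent plane graph) with over/under information at each crossing. All diagrams are assumed to have a connected underlying projection graph ("connected"). $D$ is alternating if, travelling along each link component, over- and under-crossings alternate. $D$ is reduced if it has no nugatory crossing, i.e. no crossing at which some region of the projection meets itself from opposite corners. Smoothing all crossings of $D$ according to the orientation (Seifert's algorithm) gives a collection of Seifert circles in the plane bounding Seifert disks; $D$ is special if the Seifert disks are not nested. For a special diagram the regions of $D$ are checkerboard coloured so that the shaded regions correspond to the Seifert surface (the Seifert disks, joined by half-twisted bands at the crossings); thus the unbounded region is unshaded. Tait graph $\Gamma(D)$. Its vertices are the unshaded regions of $D$; for every crossing there is one directed edge joining the two unshaded regions meeting at that crossing (multiple edges are allowed). At a crossing, the two unshaded regions meeting there are the one lying between the two incoming arcs and the one lying between the two outgoing arcs. The edge through the crossing is directed so that the over-strand crosses the edge from left to right, the same rule being used at all crossings. The edge has weight $-1$ if the crossing is positive and $+1$ if it is negative (standard sign convention for oriented crossings). It is a known fact that all crossings of a connected special alternating diagram have the same sign, so all edges of $\Gamma(D)$ have the same weight $\omega$. Laplacian. For a weighted directed graph $\Gamma$ with vertices $v_1,\dots,v_n$, $L(\Gamma)$ is the $n\times n$ matrix whose diagonal entry $L_{ii}$ is the weighted out-degree of $v_i$ (sum of the weights of the edges with initial vertex $v_i$), and whose entry $L_{ij}$, $i\ne j$, is $-1$ times the sum of the weights of the edges from $v_i$ to $v_j$. $M^{+}$ denotes the Moore–Penrose pseudoinverse of a real matrix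 $M$, and $FP(D)=\operatorname{tr}(L^{T}L^{+})$ with $L=L(\Gamma(D))$. *)

theory Defs
  imports
    "HOL-Combinatorics.Orbits"
    "Graph_Theory.Digraph"
    "Jordan_Normal_Form.Matrix"
begin

section \<open>Oriented link diagrams\<close>

text \<open>
  A link diagram with connected projection is encoded as a combinatorial map. A dart is a
  half-edge of the 4-valent projection graph, viewed from the crossing at which it is attached.
  The permutation \<open>rot\<close> sends a dart to the next one in counterclockwise order around its
  crossing, and \<open>opp\<close> exchanges the two halves of an arc. The dart \<open>d\<close> also names the corner
  swept out counterclockwise from \<open>d\<close> to \<open>rot d\<close>.

  A dart is in \<open>incoming\<close> if the orientation of the link along it points towards its crossing,
  and in \<open>over\<close> if it belongs to the over-strand of its crossing. The dart \<open>outer\<close> is a corner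
  of the unbounded region; it singles out the plane among embeddings into the sphere.
\<close>

record 'd diagram =
  darts :: "'d set"
  rot :: "'d \<Rightarrow> 'd"
  opp :: "'d \<Rightarrow> 'd"
  incoming :: "'d set"
  over :: "'d set"
  outer :: 'd

definition crossings :: "'d diagram \<Rightarrow> 'd set set" where
  "crossings D = orbit (rot D) ` darts D"

definition plane_arcs :: "'d diagram \<Rightarrow> 'd set set" where
  "plane_arcs D = (\<lambda>d. {d, opp D d}) ` darts D"

text \<open>
  Corner \<open>d\<close> lies to the right of the arc leaving the crossing along \<open>rot d\<close>, hence to the left
  of the same arc leaving its other end along \<open>opp (rot d)\<close>. So the corners of one region form
  an orbit of \<open>opp \<circ> rot\<close>.
\<close>

definition region_at :: "'d diagram \<Rightarrow> 'd \<Rightarrow> 'd set" where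
  "region_at D d = orbit (opp D \<circ> rot D) d"

definition regions :: "'d diagram \<Rightarrow> 'd set set" where
  "regions D = region_at D ` darts D"

definition four_valent_map :: "'d diagram \<Rightarrow> bool" where
  "four_valent_map D \<longleftrightarrow>
     finite (darts D) \<and> darts D \<noteq> {} \<and>
     rot D permutes darts D \<and> (\<forall>d\<in>darts D. card (orbit (rot D) d) = 4) \<and>
     opp D permutes darts D \<and> (\<forall>d\<in>darts D. opp D d \<noteq> d \<and> opp D (opp D d) = d) \<and>
     outer D \<in> darts D"

definition connected_diagram :: "'d diagram \<Rightarrow> bool" where
  "connected_diagram D \<longleftrightarrow>
     (\<forall>d\<in>darts D. \<forall>d'\<in>darts D.
        (d, d') \<in> ({(x, rot D x) | x. x \<in> darts D} \<union> {(x, opp D x) | x. x \<in> darts D})\<^sup>*)"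

text \<open>Euler's formula: a connected map has genus 0.\<close>

definition planar_diagram :: "'d diagram \<Rightarrow> bool" where
  "planar_diagram D \<longleftrightarrow> card (crossings D) + card (regions D) = card (plane_arcs D) + 2"

definition oriented_diagram :: "'d diagram \<Rightarrow> bool" where
  "oriented_diagram D \<longleftrightarrow>
     incoming D \<subseteq> darts D \<and>
     (\<forall>d\<in>darts D. (d \<in> incoming D \<longleftrightarrow> opp D d \<notin> incoming D) \<and>
                  (d \<in> incoming D \<longleftrightarrow> rot D (rot D d) \<notin> incoming D))"

definition crossing_information :: "'d diagram \<Rightarrow> bool" where
  "crossing_information D \<longleftrightarrow>
     over D \<subseteq> darts D \<and> (\<forall>d\<in>darts D. d \<in> over D \<longleftrightarrow> rot D d \<notin> over D)"

definition connected_link_diagram :: "'d diagram \<Rightarrow> bool" where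
  "connected_link_diagram D \<longleftrightarrow>
     four_valent_map D \<and> connected_diagram D \<and> planar_diagram D \<and>
     oriented_diagram D \<and> crossing_information D"

definition alternating_diagram :: "'d diagram \<Rightarrow> bool" where
  "alternating_diagram D \<longleftrightarrow> (\<forall>d\<in>darts D. d \<in> over D \<longleftrightarrow> opp D d \<notin> over D)"

definition nugatory :: "'d diagram \<Rightarrow> 'd set \<Rightarrow> bool" where
  "nugatory D c \<longleftrightarrow> (\<exists>d\<in>c. region_at D d = region_at D (rot D (rot D d)))"

definition reduced_diagram :: "'d diagram \<Rightarrow> bool" where
  "reduced_diagram D \<longleftrightarrow> (\<forall>c\<in>crossings D. \<not> nugatory D c)"


section \<open>Seifert circles and special diagrams\<close>

text \<open>
  A Seifert circle is represented by the set of incoming darts, one for each arc, that it runs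
  through. The smoothing turns from an incoming dart into the neighbouring outgoing one,
  which is \<open>rot d\<close>, or else the clockwise neighbour \<open>rot (rot (rot d))\<close>.
\<close>

definition seifert_next :: "'d diagram \<Rightarrow> 'd \<Rightarrow> 'd" where
  "seifert_next D d =
     opp D (if rot D d \<in> incoming D then rot D (rot D (rot D d)) else rot D d)"

definition seifert_circles :: "'d diagram \<Rightarrow> 'd set set" where
  "seifert_circles D = orbit (seifert_next D) ` (darts D \<inter> incoming D)"

text \<open>Corners between two incoming or between two outgoing arcs.\<close>

definition coherent_corner :: "'d diagram \<Rightarrow> 'd \<Rightarrow> bool" where
  "coherent_corner D d \<longleftrightarrow> (d \<in> incoming D \<longleftrightarrow> rot D d \<in> incoming D)"

text \<open>
  Adjacency of regions in the complement of the Seifert circle \<open>C\<close> in the plane: one may cross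
  an arc that is not on \<open>C\<close>, and one may pass through the gap opened by a smoothing, which
  merges the two opposite coherent corners of a crossing.
\<close>

definition adjacent_off :: "'d diagram \<Rightarrow> 'd set \<Rightarrow> ('d set \<times> 'd set) set" where
  "adjacent_off D C =
     {(region_at D d, region_at D (opp D d)) | d. d \<in> darts D \<and> d \<notin> C \<and> opp D d \<notin> C} \<union>
     {(region_at D d, region_at D (rot D (rot D d))) | d. d \<in> darts D \<and> coherent_corner D d}"

text \<open>
  The Seifert disk of \<open>C\<close> is the bounded side of \<open>C\<close>, represented by the regions of the
  diagram that it contains.
\<close>

definition seifert_disk :: "'d diagram \<Rightarrow> 'd set \<Rightarrow> 'd set set" where
  "seifert_disk D C = {R \<in> regions D. (region_at D (outer D), R) \<notin> (adjacent_off D C)\<^sup>*}"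

definition special_diagram :: "'d diagram \<Rightarrow> bool" where
  "special_diagram D \<longleftrightarrow>
     (\<forall>C\<in>seifert_circles D. \<forall>C'\<in>seifert_circles D.
        C \<noteq> C' \<longrightarrow> \<not> seifert_disk D C \<subseteq> seifert_disk D C')"

definition unshaded_regions :: "'d diagram \<Rightarrow> 'd set set" where
  "unshaded_regions D = {R \<in> regions D. \<forall>C\<in>seifert_circles D. R \<notin> seifert_disk D C}"


section \<open>The weighted Tait graph\<close>

definition over_in :: "'d diagram \<Rightarrow> 'd set \<Rightarrow> 'd" where
  "over_in D c = (THE d. d \<in> c \<and> d \<in> over D \<and> d \<in> incoming D)"

text \<open>
  A crossing is positive if the counterclockwise turn from the over-strand to the under-strand,
  both directed, is less than a half turn: the next dart counterclockwise from the incoming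
  over-dart is then the incoming under-dart.
\<close>

definition positive_crossing :: "'d diagram \<Rightarrow> 'd set \<Rightarrow> bool" where
  "positive_crossing D c \<longleftrightarrow> rot D (over_in D c) \<in> incoming D"

definition tait_weight :: "'d diagram \<Rightarrow> 'd set \<Rightarrow> real" where
  "tait_weight D c = (if positive_crossing D c then -1 else 1)"

text \<open>
  With \<open>a\<close> the incoming over-dart, the corners \<open>a\<close> and \<open>rot a\<close> lie to the right of the
  over-strand, and exactly one of them is coherent. The over-strand crosses the edge from left
  to right when the edge starts to the right of the over-strand and ends to the left of it.
\<close>

definition tail_corner :: "'d diagram \<Rightarrow> 'd set \<Rightarrow> 'd" where
  "tail_corner D c =
     (let a = over_in D c in if coherent_corner D a then a else rot D a)"

definition tait_graph :: "'d diagram \<Rightarrow> ('d set, 'd set) pre_digraph" where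
  "tait_graph D =
     \<lparr> verts = unshaded_regions D,
       arcs = crossings D,
       tail = (\<lambda>c. region_at D (tail_corner D c)),
       head = (\<lambda>c. region_at D (rot D (rot D (tail_corner D c)))) \<rparr>"

definition common_weight :: "'d diagram \<Rightarrow> real" where
  "common_weight D = (THE w. \<forall>e\<in>arcs (tait_graph D). tait_weight D e = w)"


section \<open>Laplacian, pseudoinverse and the invariant\<close>

text \<open>The vertices are enumerated as \<open>v 0, \<dots>, v (n - 1)\<close>.\<close>

definition vertex_enumeration :: "('v, 'e) pre_digraph \<Rightarrow> (nat \<Rightarrow> 'v) \<Rightarrow> bool" where
  "vertex_enumeration G v \<longleftrightarrow> finite (verts G) \<and> bij_betw v {..<card (verts G)} (verts G)"

definition vertex_index :: "('v, 'e) pre_digraph \<Rightarrow> (nat \<Rightarrow> 'v) \<Rightarrow> 'v \<Rightarrow> nat" where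
  "vertex_index G v = inv_into {..<card (verts G)} v"

definition laplacian :: "('v, 'e) pre_digraph \<Rightarrow> ('e \<Rightarrow> real) \<Rightarrow> (nat \<Rightarrow> 'v) \<Rightarrow> real mat" where
  "laplacian G w v = mat (card (verts G)) (card (verts G)) (\<lambda>(i, j).
     if i = j then \<Sum>e\<in>out_arcs G (v i). w e
     else - (\<Sum>e | e \<in> arcs G \<and> tail G e = v i \<and> head G e = v j. w e))"

definition is_pseudoinverse :: "real mat \<Rightarrow> real mat \<Rightarrow> bool" where
  "is_pseudoinverse M X \<longleftrightarrow>
     X \<in> carrier_mat (dim_col M) (dim_row M) \<and>
     M * X * M = M \<and> X * M * X = X \<and>
     transpose_mat (M * X) = M * X \<and> transpose_mat (X * M) = X * M"

definition pseudoinverse :: "real mat \<Rightarrow> real mat" where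
  "pseudoinverse M = (THE X. is_pseudoinverse M X)"

definition mat_trace :: "real mat \<Rightarrow> real" where
  "mat_trace M = (\<Sum>i<dim_row M. M $$ (i, i))"

definition tait_laplacian :: "'d diagram \<Rightarrow> (nat \<Rightarrow> 'd set) \<Rightarrow> real mat" where
  "tait_laplacian D v = laplacian (tait_graph D) (tait_weight D) v"

definition FP :: "'d diagram \<Rightarrow> (nat \<Rightarrow> 'd set) \<Rightarrow> real" where
  "FP D v = mat_trace (transpose_mat (tait_laplacian D v) * pseudoinverse (tait_laplacian D v))"

definition edge_resistance ::
    "('v, 'e) pre_digraph \<Rightarrow> (nat \<Rightarrow> 'v) \<Rightarrow> real mat \<Rightarrow> 'e \<Rightarrow> real" where
  "edge_resistance G v M e =
     (let i = vertex_index G v (tail G e); j = vertex_index G v (head G e)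
      in pseudoinverse M $$ (i, i) + pseudoinverse M $$ (j, j) - 2 * pseudoinverse M $$ (i, j))"

end

theory Submission
  imports Defs "Jordan_Normal_Form.Gauss_Jordan_Elimination"
begin

text \<open>
  Let \<open>X = L\<^sup>+\<close>. If at every vertex of a loopless weighted digraph the total weight of the outgoing
  edges equals that of the incoming ones, then summing \<open>X\<^sub>i\<^sub>i + X\<^sub>j\<^sub>j - 2 X\<^sub>i\<^sub>j\<close> over the weighted
  edges counts every diagonal term \<open>L\<^sub>i\<^sub>i X\<^sub>i\<^sub>i\<close> twice and every off-diagonal term \<open>L\<^sub>i\<^sub>j X\<^sub>i\<^sub>j\<close> twice, so it
  equals \<open>2 tr (L\<^sup>T X)\<close>. This is lemma \<open>trace_laplacian_transpose_mult\<close>, which holds for any matrix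
  \<open>X\<close>. The pseudoinverse matters only for comparing \<open>\<rho>\<close> with \<open>r\<close>: since a real matrix has exactly one
  Moore-Penrose inverse, \<open>(\<omega> L)\<^sup>+ = \<omega> L\<^sup>+\<close> for \<open>\<omega> = \<plusminus>1\<close>.

  It remains to see that the Tait graph is a loopless, balanced digraph on the unshaded regions
  whose edges all have the same weight. There are no loops because the diagram is reduced. For the
  rest the key fact is that in a special diagram a corner is coherent, that is, lies between two
  incoming or between two outgoing arcs, if and only if its region is unshaded (lemma
  \<open>coherent_iff_unshaded\<close>). Hence along the boundary of an unshaded region the corners alternate
  between incoming and outgoing, while in an alternating diagram the dart at which a corner starts
  is an over-dart either at all corners of the region or at none. These two bits decide whether the
  edge through a corner starts or ends in the region, so starts and ends alternate
  (\<open>tait_graph_balanced\<close>); the second bit alone is the sign of the crossing, so by connectedness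
  all signs agree
  (\<open>positive_crossing_constant\<close>).

  The key fact rests on a Jordan curve theorem for Seifert circles
  (\<open>seifert_circle_separates\<close>). By Euler's formula, counting modulo 2, every set of arcs that meets
  each crossing evenly is the set of arcs separating some set of regions from its complement
  (\<open>even_arc_set_is_region_cut\<close>); this applies to the arcs of a Seifert circle. If another Seifert
  circle lay inside the disk of \<open>C\<close>, one of the two disks would contain the other, so in a special
  diagram every circle lies outside all other disks. The coherent corners of a crossing lie beside
  both of the two distinct circles that meet there, so they are in no disk, and each incoherent
  corner is across one of these circles from a coherent one, so it is in the disk of that circle.
\<close>

section \<open>The Moore-Penrose inverse of a real matrix\<close>

text \<open>
  If \<open>R = P A\<close> is the reduced row echelon form of \<open>A\<close> with \<open>P\<close> invertible, the 0-1 matrix \<open>T\<close> that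
  sends each pivot row to its pivot column satisfies \<open>R T R = R\<close>, and \<open>T P\<close> is a generalized inverse
  of \<open>A\<close>.
\<close>

lemma generalized_inverse_exists:
  fixes A :: "'a :: field mat"
  assumes A: "A \<in> carrier_mat m n"
  shows "\<exists>G \<in> carrier_mat n m. A * G * A = A"
proof -
  obtain R B where gj: "gauss_jordan A (0\<^sub>m m 0) = (R, B)"
    by fastforce
  from gauss_jordan_transform[OF A zero_carrier_mat gj, of "()", unfolded ring_mat_def Units_def, simplified]
  obtain P Q where P: "P \<in> carrier_mat m m" and Q: "Q \<in> carrier_mat m m"
    and QP: "Q * P = 1\<^sub>m m" and R_eq: "R = P * A"
    by auto
  from R_eq P A have R: "R \<in> carrier_mat m n" by auto
  from gauss_jordan_row_echelon[OF A gj] R obtain f where f: "pivot_fun R f n"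
    unfolding row_echelon_form_def by auto
  have dimR: "dim_row R = m" using R by simp
  note piv = pivot_funD[OF dimR f]
  define T where "T = mat n m (\<lambda>(j, i). if f i = j then 1 else (0 :: 'a))"
  have T: "T \<in> carrier_mat n m" by (simp add: T_def)
  \<comment> \<open>A row index \<open>k\<close> carries a pivot if \<open>f k < n\<close>; the pivot columns of \<open>R\<close> are unit vectors.\<close>
  have RT: "(R * T) $$ (i, k) = (if f k < n \<and> i = k then 1 else 0)" if "i < m" "k < m" for i k
  proof -
    have "(R * T) $$ (i, k) = (\<Sum>j<n. R $$ (i, j) * (if f k = j then 1 else 0))"
      using that R T by (simp add: T_def scalar_prod_def atLeast0LessThan)
    also have "\<dots> = (if f k < n then R $$ (i, f k) else 0)"
      by (simp add: if_distrib[of "\<lambda>z. _ * z"] sum.delta' cong: if_cong)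
    finally show ?thesis using piv(4,5) that by auto
  qed
  have RTR: "R * T * R = R"
  proof (rule eq_matI)
    fix i j assume ij: "i < dim_row R" "j < dim_col R"
    then have i: "i < m" and j: "j < n" using R by auto
    have RTc: "R * T \<in> carrier_mat m m" using R T by auto
    have "(M * R) $$ (i, j) = (\<Sum>k<m. M $$ (i, k) * R $$ (k, j))" if "M \<in> carrier_mat m m" for M
      using i j R that by (simp add: scalar_prod_def atLeast0LessThan)
    from this[OF RTc] have "(R * T * R) $$ (i, j) = (\<Sum>k<m. (R * T) $$ (i, k) * R $$ (k, j))" .
    also have "\<dots> = (\<Sum>k<m. if k = i then (if f i < n then R $$ (i, j) else 0) else 0)"
      by (rule sum.cong) (auto simp: RT i)
    also have "\<dots> = (if f i < n then R $$ (i, j) else 0)" using i by simp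
    also have "\<dots> = R $$ (i, j)" using piv(1,2)[OF i] j by auto
    finally show "(R * T * R) $$ (i, j) = R $$ (i, j)" .
  qed (use R T in auto)
  have QR: "Q * R = A" 
    using assoc_mult_mat[OF Q P A, symmetric] QP left_mult_one_mat[OF A] by (simp add: R_eq)
  have "A * (T * P) * A = A * T * R"
    unfolding R_eq using A T P by (simp add: assoc_mult_mat[of _ m n _ m _ n] assoc_mult_mat[of _ n m _ m _ n] assoc_mult_mat[of _ m m _ m _ n] assoc_mult_mat[of _ m n _ m _ m])
  also have "\<dots> = Q * (R * T * R)"
    unfolding QR[symmetric] using Q R T by (simp add: assoc_mult_mat[of _ m m _ n _ m] assoc_mult_mat[of _ m m _ m _ n])
  also have "\<dots> = A" by (simp add: RTR QR)
  finally show ?thesis using T P by (intro bexI[of _ "T * P"]) auto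
qed

lemma transpose_mult_self_eq_0:
  fixes B :: "real mat"
  assumes B: "B \<in> carrier_mat m n" and eq: "transpose_mat B * B = 0\<^sub>m n n"
  shows "B = 0\<^sub>m m n"
proof (rule eq_matI)
  fix i j assume "i < dim_row (0\<^sub>m m n)" "j < dim_col (0\<^sub>m m n)"
  then have i: "i < m" and j: "j < n" by auto
  have "(\<Sum>k<m. B $$ (k, j) * B $$ (k, j)) = (transpose_mat B * B) $$ (j, j)"
    using B j by (simp add: scalar_prod_def atLeast0LessThan)
  also have "\<dots> = 0" using eq j by simp
  finally have "\<forall>k\<in>{..<m}. B $$ (k, j) * B $$ (k, j) = 0"
    by (subst (asm) sum_nonneg_eq_0_iff) auto
  then show "B $$ (i, j) = 0\<^sub>m m n $$ (i, j)" using i j by auto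
qed (use B in auto)

text \<open>
  Least squares: \<open>X = G A\<^sup>T\<close>, where \<open>G\<close> is any generalized inverse of the Gram matrix \<open>A\<^sup>T A\<close>, makes
  \<open>A X\<close> the orthogonal projection onto the column space of \<open>A\<close>.
\<close>

lemma symmetric_right_generalized_inverse_exists:
  fixes A :: "real mat"
  assumes A: "A \<in> carrier_mat m n"
  shows "\<exists>X \<in> carrier_mat n m. A * X * A = A \<and> transpose_mat (A * X) = A * X"
proof -
  let ?T = "transpose_mat A"
  have T: "?T \<in> carrier_mat n m" using A by simp
  have S: "?T * A \<in> carrier_mat n n" using A by simp
  obtain G where G: "G \<in> carrier_mat n n" and GS: "?T * A * G * (?T * A) = ?T * A"
    using generalized_inverse_exists[OF S] by blast
  define X where "X = G * ?T"
  have X: "X \<in> carrier_mat n m" using G A by (simp add: X_def)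
  define P where "P = A * X"
  have P: "P \<in> carrier_mat m m" using A X by (simp add: P_def)
  define B where "B = P * A - A"
  have PA: "P * A \<in> carrier_mat m n" using P A by simp
  have B: "B \<in> carrier_mat m n" unfolding B_def using A by (rule minus_carrier_mat)
  \<comment> \<open>\<open>A\<^sup>T B = 0\<close>, and \<open>B\<close> factors through \<open>A\<close> on the left, so \<open>B\<^sup>T B = 0\<close>.\<close>
  have TP: "?T * P = ?T * A * G * ?T"
    unfolding P_def X_def
    using assoc_mult_mat[OF S G T] assoc_mult_mat[OF T A, of "G * ?T" m] G T by simp
  have "?T * (P * A) = ?T * A"
    using assoc_mult_mat[OF T P A] TP GS assoc_mult_mat[OF mult_carrier_mat[OF S G] T A] by simp
  then have TB: "?T * B = 0\<^sub>m n n"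
    unfolding B_def using mult_minus_distrib_mat[OF T PA A] minus_r_inv_mat[OF S] by simp
  have BT: "transpose_mat B = (transpose_mat (X * A) - 1\<^sub>m n) * ?T"
  proof -
    have "P * A = A * (X * A)" unfolding P_def using A X by (simp add: assoc_mult_mat[OF A X A])
    then have B_eq: "B = A * (X * A - 1\<^sub>m n)"
      unfolding B_def using A X
      by (subst mult_minus_distrib_mat[OF A, of _ n]) (auto simp: right_mult_one_mat[OF A])
    then show ?thesis using A X
      by (subst B_eq, subst transpose_mult[OF A, of _ n]) (auto simp: transpose_minus[OF mult_carrier_mat[OF X A] one_carrier_mat])
  qed
  have "transpose_mat B * B = (transpose_mat (X * A) - 1\<^sub>m n) * (?T * B)"
    unfolding BT by (rule assoc_mult_mat[of _ n n _ m _ n]) (use A X B in auto)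
  also have "\<dots> = 0\<^sub>m n n" unfolding TB using A X by (intro right_mult_zero_mat) auto
  finally have "B = 0\<^sub>m m n" by (rule transpose_mult_self_eq_0[OF B])
  have PAA: "P * A = A"
  proof (rule eq_matI)
    fix i j assume ij: "i < dim_row A" "j < dim_col A"
    then have "B $$ (i, j) = 0" using \<open>B = 0\<^sub>m m n\<close> A by auto
    then show "(P * A) $$ (i, j) = A $$ (i, j)"
      using ij PA A by (simp add: B_def)
  qed (use carrier_matD[OF PA] carrier_matD[OF A] in simp_all)
  have AGT: "A * G * ?T = P"
    unfolding P_def X_def by (rule assoc_mult_mat[OF A G T])
  \<comment> \<open>\<open>P P\<^sup>T = P\<close> exhibits \<open>P\<close> as a symmetric matrix.\<close>
  have "P * transpose_mat P = A * G * (?T * transpose_mat P)"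
    using assoc_mult_mat[OF mult_carrier_mat[OF A G] T, of "transpose_mat P" m] P AGT by simp
  also have "?T * transpose_mat P = ?T"
    using transpose_mult[OF P A] PAA by simp
  also note AGT
  finally have "transpose_mat P = P"
    using transpose_mult[OF P, of "transpose_mat P" m] P by simp
  then show ?thesis using PAA X unfolding P_def by blast
qed

lemma is_pseudoinverse_exists:
  fixes A :: "real mat"
  shows "\<exists>X. is_pseudoinverse A X"
proof -
  define m n where "m = dim_row A" and "n = dim_col A"
  have A: "A \<in> carrier_mat m n" by (simp add: m_def n_def)
  obtain X where X: "X \<in> carrier_mat n m" and X1: "A * X * A = A"
    and X2: "transpose_mat (A * X) = A * X"
    using symmetric_right_generalized_inverse_exists[OF A] by blast
  have TA: "transpose_mat A \<in> carrier_mat n m" using A by simp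
  obtain Y' where Y': "Y' \<in> carrier_mat m n"
    and Y'1: "transpose_mat A * Y' * transpose_mat A = transpose_mat A"
    and Y'2: "transpose_mat (transpose_mat A * Y') = transpose_mat A * Y'"
    using symmetric_right_generalized_inverse_exists[OF TA] by blast
  define Y where "Y = transpose_mat Y'"
  have Y: "Y \<in> carrier_mat n m" using Y' by (simp add: Y_def)
  have YA: "transpose_mat (transpose_mat A * Y') = Y * A"
    using transpose_mult[OF TA Y'] by (simp add: Y_def)
  have Y2: "transpose_mat (Y * A) = Y * A" using YA Y'2 by simp
  have "transpose_mat (transpose_mat A * Y' * transpose_mat A) = A * (Y * A)"
    using transpose_mult[of "transpose_mat A * Y'" n n "transpose_mat A" m] TA Y' YA by simp
  then have Y1: "A * Y * A = A" using Y'1 A Y by (simp add: assoc_mult_mat[OF A Y A])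
  \<comment> \<open>The left one-sided inverse \<open>Y\<close> and the right one \<open>X\<close> combine to the two-sided inverse \<open>Y A X\<close>.\<close>
  let ?Z = "Y * A * X"
  have YAc: "Y * A \<in> carrier_mat n n" and XAc: "X * A \<in> carrier_mat n n"
    using A X Y by auto
  have Z: "?Z \<in> carrier_mat n m" using YAc X by auto
  have AZ: "A * ?Z = A * X"
    using assoc_mult_mat[OF A YAc X] assoc_mult_mat[OF A Y A] Y1 by simp
  have ZA: "?Z * A = Y * A"
    using assoc_mult_mat[OF YAc X A] assoc_mult_mat[OF Y A XAc] assoc_mult_mat[OF A X A] X1 by simp
  have "?Z * A * ?Z = Y * (A * ?Z)"
    unfolding ZA by (rule assoc_mult_mat[OF Y A Z])
  also have "\<dots> = ?Z" unfolding AZ by (rule assoc_mult_mat[OF Y A X, symmetric])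
  finally have "is_pseudoinverse A ?Z"
    unfolding is_pseudoinverse_def using Z AZ ZA X1 X2 Y2 by (simp add: m_def n_def)
  then show ?thesis ..
qed

lemma is_pseudoinverse_unique:
  assumes "is_pseudoinverse A X" and "is_pseudoinverse A Y"
  shows "X = Y"
proof -
  define m n where "m = dim_row A" and "n = dim_col A"
  have A: "A \<in> carrier_mat m n" by (simp add: m_def n_def)
  have X: "X \<in> carrier_mat n m" and Y: "Y \<in> carrier_mat n m"
    and X1: "A * X * A = A" and X2: "X * A * X = X" and X3: "transpose_mat (A * X) = A * X"
    and X4: "transpose_mat (X * A) = X * A"
    and Y1: "A * Y * A = A" and Y2: "Y * A * Y = Y" and Y3: "transpose_mat (A * Y) = A * Y"
    and Y4: "transpose_mat (Y * A) = Y * A"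
    using assms by (simp_all add: is_pseudoinverse_def m_def n_def)
  have YAc: "Y * A \<in> carrier_mat n n" and AYc: "A * Y \<in> carrier_mat m m"
    and XAc: "X * A \<in> carrier_mat n n" and AXc: "A * X \<in> carrier_mat m m"
    using A X Y by auto
  have "A * X = (A * Y) * (A * X)"
    using assoc_mult_mat[OF AYc A X] Y1 by simp
  also have "\<dots> = transpose_mat ((A * X) * (A * Y))"
    using transpose_mult[OF AXc AYc] X3 Y3 by simp
  also have "\<dots> = A * Y"
    using assoc_mult_mat[OF AXc A Y] X1 Y3 by simp
  finally have AXY: "A * X = A * Y" .
  have "X * A = (X * A) * (Y * A)"
    using assoc_mult_mat[OF X A YAc] assoc_mult_mat[OF A Y A] Y1 by simp
  also have "\<dots> = transpose_mat ((Y * A) * (X * A))"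
    using transpose_mult[OF YAc XAc] X4 Y4 by simp
  also have "\<dots> = Y * A"
    using assoc_mult_mat[OF Y A XAc] assoc_mult_mat[OF A X A] X1 Y4 by simp
  finally have XAY: "X * A = Y * A" .
  have "X = Y * A * X" using X2 XAY by simp
  also have "\<dots> = Y * A * Y" using assoc_mult_mat[OF Y A X] assoc_mult_mat[OF Y A Y] AXY by simp
  finally show ?thesis using Y2 by simp
qed

lemma pseudoinverse_eqI: "is_pseudoinverse A X \<Longrightarrow> pseudoinverse A = X"
  unfolding pseudoinverse_def using is_pseudoinverse_unique by (intro the_equality) auto

lemma is_pseudoinverse_pseudoinverse:
  fixes A :: "real mat"
  shows "is_pseudoinverse A (pseudoinverse A)"
  using is_pseudoinverse_exists[of A] pseudoinverse_eqI by metis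

lemma pseudoinverse_smult:
  fixes A :: "real mat" and c :: real
  assumes "c \<noteq> 0"
  shows "pseudoinverse (c \<cdot>\<^sub>m A) = inverse c \<cdot>\<^sub>m pseudoinverse A"
proof (rule pseudoinverse_eqI)
  define X where "X = pseudoinverse A"
  define m n where "m = dim_row A" and "n = dim_col A"
  have A: "A \<in> carrier_mat m n" by (simp add: m_def n_def)
  have X: "X \<in> carrier_mat n m"
    and X1: "A * X * A = A" and X2: "X * A * X = X" and X3: "transpose_mat (A * X) = A * X"
    and X4: "transpose_mat (X * A) = X * A"
    using is_pseudoinverse_pseudoinverse[of A]
    by (simp_all add: is_pseudoinverse_def m_def n_def X_def)
  have one: "1 \<cdot>\<^sub>m M = M" for M :: "real mat" by (intro eq_matI) auto
  have smult_smult: "a \<cdot>\<^sub>m (b \<cdot>\<^sub>m M) = (a * b) \<cdot>\<^sub>m M" for a b :: real and M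
    by (intro eq_matI) auto
  have AX: "(c \<cdot>\<^sub>m A) * (inverse c \<cdot>\<^sub>m X) = A * X"
    using A X assms by (simp add: mult_smult_distrib[of _ m n _ m]
        mult_smult_assoc_mat[of _ m n _ m] smult_smult one)
  have XA: "(inverse c \<cdot>\<^sub>m X) * (c \<cdot>\<^sub>m A) = X * A"
    using A X assms by (simp add: mult_smult_distrib[of _ n m _ n]
        mult_smult_assoc_mat[of _ n m _ n] smult_smult one)
  have 1: "A * X * (c \<cdot>\<^sub>m A) = c \<cdot>\<^sub>m A"
    using A X X1 by (simp add: mult_smult_distrib[of _ m m _ n])
  have 2: "X * A * (inverse c \<cdot>\<^sub>m X) = inverse c \<cdot>\<^sub>m X"
    using A X X2 by (simp add: mult_smult_distrib[of _ n n _ m])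
  show "is_pseudoinverse (c \<cdot>\<^sub>m A) (inverse c \<cdot>\<^sub>m X)"
    unfolding is_pseudoinverse_def AX XA 1 2 using X X3 X4 by (simp add: m_def n_def)
qed

section \<open>Traces against the Laplacian of a balanced digraph\<close>

lemma sum_tail_eq_sum_head:
  fixes w :: "'e \<Rightarrow> real" and f :: "'v \<Rightarrow> real"
  assumes "finite (arcs G)" and "finite (verts G)"
    and "\<And>e. e \<in> arcs G \<Longrightarrow> tail G e \<in> verts G" and "\<And>e. e \<in> arcs G \<Longrightarrow> head G e \<in> verts G"
    and balanced: "\<And>x. x \<in> verts G \<Longrightarrow> (\<Sum>e\<in>out_arcs G x. w e) = (\<Sum>e\<in>in_arcs G x. w e)"
  shows "(\<Sum>e\<in>arcs G. w e * f (tail G e)) = (\<Sum>e\<in>arcs G. w e * f (head G e))"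
proof -
  have "(\<Sum>e\<in>arcs G. w e * f (tail G e)) = (\<Sum>x\<in>verts G. \<Sum>e\<in>out_arcs G x. w e * f (tail G e))"
    unfolding out_arcs_def using assms by (intro sum.group[symmetric]) auto
  also have "\<dots> = (\<Sum>x\<in>verts G. \<Sum>e\<in>in_arcs G x. w e * f (head G e))"
    by (rule sum.cong) (simp_all add: balanced sum_distrib_right[symmetric])
  also have "\<dots> = (\<Sum>e\<in>arcs G. w e * f (head G e))"
    unfolding in_arcs_def using assms by (intro sum.group) auto
  finally show ?thesis .
qed

lemma trace_laplacian_transpose_mult:
  fixes w :: "'e \<Rightarrow> real" and X :: "real mat"
  assumes v: "vertex_enumeration G v" and fin: "finite (arcs G)"
    and tail: "\<And>e. e \<in> arcs G \<Longrightarrow> tail G e \<in> verts G"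
    and head: "\<And>e. e \<in> arcs G \<Longrightarrow> head G e \<in> verts G"
    and loopless: "\<And>e. e \<in> arcs G \<Longrightarrow> tail G e \<noteq> head G e"
    and balanced: "\<And>x. x \<in> verts G \<Longrightarrow> (\<Sum>e\<in>out_arcs G x. w e) = (\<Sum>e\<in>in_arcs G x. w e)"
    and X: "X \<in> carrier_mat (card (verts G)) (card (verts G))"
  defines "idx \<equiv> vertex_index G v"
  shows "mat_trace (transpose_mat (laplacian G w v) * X) =
    1 / 2 * (\<Sum>e\<in>arcs G. w e * (X $$ (idx (tail G e), idx (tail G e))
      + X $$ (idx (head G e), idx (head G e)) - 2 * X $$ (idx (tail G e), idx (head G e))))"
proof -
  define n where "n = card (verts G)"
  define t h where "t e = idx (tail G e)" and "h e = idx (head G e)" for e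
  have finV: "finite (verts G)" and bij: "bij_betw v {..<n} (verts G)"
    using v by (auto simp: vertex_enumeration_def n_def)
  have idx: "idx x < n" "v (idx x) = x" if "x \<in> verts G" for x
    using bij_betw_inv_into[OF bij] bij_betw_inv_into_right[OF bij that] that
    by (auto simp: idx_def vertex_index_def n_def bij_betw_def)
  have eq_v: "x = v i \<longleftrightarrow> idx x = i" if "x \<in> verts G" "i < n" for x i
    using bij_betw_inv_into_left[OF bij, of i] idx(2)[OF that(1)] that
    by (auto simp: idx_def vertex_index_def n_def)
  have t: "t e < n" and h: "h e < n" if "e \<in> arcs G" for e
    using idx(1) tail head that by (auto simp: t_def h_def)
  have th: "t e \<noteq> h e" if "e \<in> arcs G" for e
    using idx(2) tail head loopless that unfolding t_def h_def by metis
  let ?L = "laplacian G w v"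
  \<comment> \<open>Without loops the two cases of the definition merge: \<open>L\<close> is the sum over the edges
    \<open>e\<close> of \<open>w e\<close> times the matrix with a 1 at \<open>(t e, t e)\<close> and a -1 at \<open>(t e, h e)\<close>.\<close>
  have L: "?L $$ (k, i) = (\<Sum>e\<in>arcs G. w e * ((if t e = k \<and> i = k then 1 else 0)
        - (if t e = k \<and> h e = i then 1 else 0)))" if "k < n" "i < n" for k i
  proof -
    have *: "{e \<in> arcs G. tail G e = v k} = {e \<in> arcs G. t e = k}"
      "{e \<in> arcs G. tail G e = v k \<and> head G e = v i} = {e \<in> arcs G. t e = k \<and> h e = i}"
      using eq_v tail head that unfolding t_def h_def by blast+
    show ?thesis
    proof (cases "k = i")
      case True
      then have "?L $$ (k, i) = (\<Sum>e | e \<in> arcs G \<and> t e = k. w e)"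
        using that * by (simp add: laplacian_def n_def out_arcs_def)
      also have "\<dots> = (\<Sum>e\<in>arcs G. if t e = k then w e else 0)"
        by (rule sum.inter_filter[OF fin])
      also have "\<dots> = (\<Sum>e\<in>arcs G. w e * ((if t e = k \<and> i = k then 1 else 0)
        - (if t e = k \<and> h e = i then 1 else 0)))"
        using th True by (intro sum.cong) auto
      finally show ?thesis .
    next
      case False
      then have "?L $$ (k, i) = - (\<Sum>e | e \<in> arcs G \<and> t e = k \<and> h e = i. w e)"
        using that * by (simp add: laplacian_def n_def)
      also have "\<dots> = - (\<Sum>e\<in>arcs G. if t e = k \<and> h e = i then w e else 0)"
        using sum.inter_filter[OF fin, of w "\<lambda>e. t e = k \<and> h e = i"] by simp
      also have "\<dots> = (\<Sum>e\<in>arcs G. w e * ((if t e = k \<and> i = k then 1 else 0)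
        - (if t e = k \<and> h e = i then 1 else 0)))"
        unfolding sum_negf[symmetric] using False by (intro sum.cong) auto
      finally show ?thesis .
    qed
  qed
  have pick: "(\<Sum>i<n. \<Sum>k<n. ((if a = k \<and> i = k then 1 else 0) - (if a = k \<and> b = i then 1 else 0))
      * X $$ (k, i)) = X $$ (a, a) - X $$ (a, b)" if "a < n" "b < n" for a b
  proof -
    have "(\<Sum>i<n. \<Sum>k<n. ((if a = k \<and> i = k then 1 else 0) - (if a = k \<and> b = i then 1 else 0))
      * X $$ (k, i)) = (\<Sum>i<n. \<Sum>k<n. if k = a then
          ((if i = a then X $$ (a, a) else 0) - (if i = b then X $$ (a, b) else 0)) else 0)"
      by (intro sum.cong) auto
    then show ?thesis using that by (simp add: sum_subtractf)
  qed
  have "mat_trace (transpose_mat ?L * X) = (\<Sum>i<n. \<Sum>k<n. ?L $$ (k, i) * X $$ (k, i))"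
    using X by (simp add: mat_trace_def laplacian_def n_def scalar_prod_def atLeast0LessThan)
  also have "\<dots> = (\<Sum>i<n. \<Sum>k<n. \<Sum>e\<in>arcs G. w e * (((if t e = k \<and> i = k then 1 else 0)
        - (if t e = k \<and> h e = i then 1 else 0)) * X $$ (k, i)))"
    by (intro sum.cong refl) (simp add: L sum_distrib_right mult.assoc)
  also have "\<dots> = (\<Sum>i<n. \<Sum>e\<in>arcs G. \<Sum>k<n. w e * (((if t e = k \<and> i = k then 1 else 0)
        - (if t e = k \<and> h e = i then 1 else 0)) * X $$ (k, i)))"
    by (intro sum.cong refl sum.swap)
  also have "\<dots> = (\<Sum>e\<in>arcs G. \<Sum>i<n. \<Sum>k<n. w e * (((if t e = k \<and> i = k then 1 else 0)
        - (if t e = k \<and> h e = i then 1 else 0)) * X $$ (k, i)))"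
    by (rule sum.swap)
  also have "\<dots> = (\<Sum>e\<in>arcs G. w e * (X $$ (t e, t e) - X $$ (t e, h e)))"
    by (intro sum.cong refl) (simp only: sum_distrib_left[symmetric] pick t h)
  finally have trace: "mat_trace (transpose_mat ?L * X)
      = (\<Sum>e\<in>arcs G. w e * X $$ (t e, t e)) - (\<Sum>e\<in>arcs G. w e * X $$ (t e, h e))"
    by (simp add: right_diff_distrib sum_subtractf)
  have "(\<Sum>e\<in>arcs G. w e * X $$ (t e, t e)) = (\<Sum>e\<in>arcs G. w e * X $$ (h e, h e))"
    unfolding t_def h_def
    by (rule sum_tail_eq_sum_head[where f = "\<lambda>x. X $$ (idx x, idx x)"])
      (use fin finV tail head balanced in auto)
  then have "mat_trace (transpose_mat ?L * X) =
    1 / 2 * (\<Sum>e\<in>arcs G. w e * (X $$ (t e, t e) + X $$ (h e, h e) - 2 * X $$ (t e, h e)))"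
    unfolding trace by (simp add: algebra_simps sum_subtractf sum.distrib sum_distrib_left)
  then show ?thesis by (simp only: t_def h_def)
qed

section \<open>Subsets modulo 2\<close>

lemma odd_card_sym_diff:
  assumes "finite P" and "finite Q"
  shows "odd (card (sym_diff P Q)) \<longleftrightarrow> odd (card P) \<noteq> odd (card Q)"
proof -
  have "card P = card (P - Q) + card (P \<inter> Q)" and "card Q = card (Q - P) + card (P \<inter> Q)"
    using card_Int_Diff[OF assms(1), of Q] card_Int_Diff[OF assms(2), of P]
    by (simp_all add: Int_commute)
  moreover have "card (sym_diff P Q) = card (P - Q) + card (Q - P)"
    using assms by (intro card_Un_disjoint) auto
  ultimately show ?thesis by presburger
qed

text \<open>
  The first isomorphism theorem for a homomorphism \<open>h\<close> from the elementary abelian 2-group of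
  subsets of \<open>A\<close> under symmetric difference.
\<close>

lemma card_Pow_eq_kernel_times_image:
  fixes h :: "'a set \<Rightarrow> 'b set"
  assumes fin: "finite A"
    and add: "\<And>X Y. X \<subseteq> A \<Longrightarrow> Y \<subseteq> A \<Longrightarrow> h (sym_diff X Y) = sym_diff (h X) (h Y)"
  shows "2 ^ card A = card {X \<in> Pow A. h X = {}} * card (h ` Pow A)"
proof -
  have fiber: "card {X \<in> Pow A. h X = y} = card {X \<in> Pow A. h X = {}}" if y: "y \<in> h ` Pow A" for y
  proof -
    obtain X\<^sub>0 where X0: "X\<^sub>0 \<subseteq> A" "y = h X\<^sub>0" using y by auto
    have "bij_betw (sym_diff X\<^sub>0) {X \<in> Pow A. h X = y} {X \<in> Pow A. h X = {}}"
    proof (rule bij_betw_byWitness[where f' = "sym_diff X\<^sub>0"])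
      have "h (sym_diff X\<^sub>0 X) = {}" if "X \<subseteq> A" "h X = y" for X
        using add[OF X0(1) that(1)] X0(2) that(2) by blast
      then show "sym_diff X\<^sub>0 ` {X \<in> Pow A. h X = y} \<subseteq> {X \<in> Pow A. h X = {}}"
        using X0(1) by blast
      have "h (sym_diff X\<^sub>0 X) = y" if "X \<subseteq> A" "h X = {}" for X
        using add[OF X0(1) that(1)] X0(2) that(2) by blast
      then show "sym_diff X\<^sub>0 ` {X \<in> Pow A. h X = {}} \<subseteq> {X \<in> Pow A. h X = y}"
        using X0(1) by blast
    qed blast+
    then show ?thesis by (rule bij_betw_same_card)
  qed
  have "2 ^ card A = (\<Sum>X\<in>Pow A. 1 :: nat)" using fin by (simp add: card_Pow)
  also have "\<dots> = (\<Sum>y\<in>h ` Pow A. \<Sum>X | X \<in> Pow A \<and> h X = y. 1)"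
    using fin by (intro sum.image_gen) auto
  also have "\<dots> = (\<Sum>y\<in>h ` Pow A. card {X \<in> Pow A. h X = {}})"
    using fiber by (intro sum.cong) auto
  finally show ?thesis by (simp add: mult.commute)
qed

lemma odd_card_filter_4:
  assumes "distinct [a, b, c, d]"
  shows "odd (card {x \<in> {a, b, c, d}. P x}) \<longleftrightarrow> (P a \<noteq> P b) \<noteq> (P c \<noteq> P d)"
proof -
  have "{x \<in> {a, b, c, d}. P x} = set (filter P [a, b, c, d])" by auto
  also have "card \<dots> = length (filter P [a, b, c, d])"
    using assms by (intro distinct_card distinct_filter)
  finally show ?thesis by simp
qed

section \<open>Diagrams as combinatorial maps\<close>

text \<open>A fixed connected diagram, about which the following parts collect facts.\<close>

locale link_diagram =
  fixes D :: "'d diagram"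
  assumes diagram: "connected_link_diagram D"
begin

lemma finite_darts: "finite (darts D)"
  and darts_nonempty: "darts D \<noteq> {}"
  and outer_in_darts: "outer D \<in> darts D"
  and rot_permutes: "rot D permutes darts D"
  and opp_permutes: "opp D permutes darts D"
  and card_crossing: "d \<in> darts D \<Longrightarrow> card (orbit (rot D) d) = 4"
  and opp_opp: "d \<in> darts D \<Longrightarrow> opp D (opp D d) = d"
  and opp_neq: "d \<in> darts D \<Longrightarrow> opp D d \<noteq> d"
  and incoming_subset: "incoming D \<subseteq> darts D"
  and incoming_opp: "d \<in> darts D \<Longrightarrow> opp D d \<in> incoming D \<longleftrightarrow> d \<notin> incoming D"
  and incoming_rot2: "d \<in> darts D \<Longrightarrow> rot D (rot D d) \<in> incoming D \<longleftrightarrow> d \<notin> incoming D"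
  and over_rot: "d \<in> darts D \<Longrightarrow> rot D d \<in> over D \<longleftrightarrow> d \<notin> over D"
  and euler: "card (crossings D) + card (regions D) = card (plane_arcs D) + 2"
  using diagram
  by (auto simp: connected_link_diagram_def four_valent_map_def oriented_diagram_def
      crossing_information_def planar_diagram_def)

lemma rot_in_darts [simp]: "rot D d \<in> darts D \<longleftrightarrow> d \<in> darts D"
  using permutes_in_image[OF rot_permutes] .

lemma opp_in_darts [simp]: "opp D d \<in> darts D \<longleftrightarrow> d \<in> darts D"
  using permutes_in_image[OF opp_permutes] .

lemma permutation_rot: "permutation (rot D)"
  using rot_permutes finite_darts unfolding permutation_permutes by blast

lemma crossing_self: "d \<in> orbit (rot D) d"
  by (rule permutation_self_in_orbit[OF permutation_rot])

lemma rot4: "rot D (rot D (rot D (rot D d))) = d"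
  and crossing_eq: "d \<in> darts D \<Longrightarrow>
        orbit (rot D) d = {d, rot D d, rot D (rot D d), rot D (rot D (rot D d))}"
  and distinct_crossing: "d \<in> darts D \<Longrightarrow>
        distinct [d, rot D d, rot D (rot D d), rot D (rot D (rot D d))]"
proof -
  have *: "rot D (rot D (rot D (rot D d))) = d \<and>
        orbit (rot D) d = {d, rot D d, rot D (rot D d), rot D (rot D (rot D d))}"
    if d: "d \<in> darts D" for d
  proof -
    let ?f = "rot D" and ?k = "funpow_dist1 (rot D) d d"
    note self = crossing_self[of d]
    have orb: "orbit ?f d = (\<lambda>n. (?f ^^ n) d) ` {0..<?k}"
      by (rule orbit_conv_funpow_dist1[OF self])
    moreover have "inj_on (\<lambda>n. (?f ^^ n) d) {0..<?k}"
      by (rule inj_on_funpow_dist1[OF self])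
    ultimately have k: "?k = 4"
      using card_crossing[OF d] card_image by fastforce
    have "(?f ^^ 4) d = d" using funpow_dist1_prop[OF self] unfolding k .
    moreover have "{0..<4::nat} = {0, 1, 2, 3}" by auto
    ultimately show ?thesis using orb unfolding k
      by (simp add: eval_nat_numeral)
  qed
  show "rot D (rot D (rot D (rot D d))) = d"
    using * rot_permutes by (cases "d \<in> darts D") (auto simp: permutes_not_in)
  show "orbit (rot D) d = {d, rot D d, rot D (rot D d), rot D (rot D (rot D d))}" if "d \<in> darts D"
    using * that by blast
  then have "card (set [d, rot D d, rot D (rot D d), rot D (rot D (rot D d))]) = 4" if "d \<in> darts D"
    using card_crossing[OF that] that by simp
  then show "distinct [d, rot D d, rot D (rot D d), rot D (rot D (rot D d))]" if "d \<in> darts D"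
    using that by (intro card_distinct) simp
qed

lemma crossing_eqI: "x \<in> orbit (rot D) d \<Longrightarrow> orbit (rot D) x = orbit (rot D) d"
  using cyclic_on_orbit[OF rot_permutes finite_darts] orbit_cyclic_eq3 by metis

lemma crossing_rot [simp]: "orbit (rot D) (rot D d) = orbit (rot D) d"
  by (intro crossing_eqI orbit.base)

lemma crossing_subset: "d \<in> darts D \<Longrightarrow> orbit (rot D) d \<subseteq> darts D"
  by (rule permutes_orbit_subset[OF rot_permutes])

lemma region_permutes: "(opp D \<circ> rot D) permutes darts D"
  by (rule permutes_compose[OF rot_permutes opp_permutes])

lemma region_self: "d \<in> region_at D d"
  unfolding region_at_def
  by (rule permutation_self_in_orbit)
    (use region_permutes finite_darts in \<open>unfold permutation_permutes, blast\<close>)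

lemma region_eqI: "x \<in> region_at D d \<Longrightarrow> region_at D x = region_at D d"
  unfolding region_at_def using cyclic_on_orbit[OF region_permutes finite_darts] orbit_cyclic_eq3 by metis

lemma region_subset: "d \<in> darts D \<Longrightarrow> region_at D d \<subseteq> darts D"
  unfolding region_at_def by (rule permutes_orbit_subset[OF region_permutes])

lemma region_step: "x \<in> region_at D d \<Longrightarrow> opp D (rot D x) \<in> region_at D d"
  unfolding region_at_def using orbit.step[of x "opp D \<circ> rot D" d] by simp

text \<open>
  The corners \<open>d\<close> and \<open>opp (rot d)\<close> are neighbours in one region. So \<open>region_at d\<close> and
  \<open>region_at (opp d)\<close> are the regions on the two sides of the arc through \<open>d\<close>.
\<close>

lemma region_opp_rot [simp]: "region_at D (opp D (rot D d)) = region_at D d"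
  by (intro region_eqI region_step region_self)

lemma region_opp: "region_at D (opp D d) = region_at D (rot D (rot D (rot D d)))"
  using region_opp_rot[of "rot D (rot D (rot D d))"] by (simp add: rot4)

lemma region_in_regions [simp]: "d \<in> darts D \<Longrightarrow> region_at D d \<in> regions D"
  by (simp add: regions_def)

lemma dart_induct:
  assumes "d\<^sub>0 \<in> darts D" and "P d\<^sub>0"
    and rot: "\<And>x. x \<in> darts D \<Longrightarrow> P x \<Longrightarrow> P (rot D x)"
    and opp: "\<And>x. x \<in> darts D \<Longrightarrow> P x \<Longrightarrow> P (opp D x)"
    and "d \<in> darts D"
  shows "P d"
proof -
  have "(d\<^sub>0, d) \<in> ({(x, rot D x) | x. x \<in> darts D} \<union> {(x, opp D x) | x. x \<in> darts D})\<^sup>*"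
    using diagram assms by (auto simp: connected_link_diagram_def connected_diagram_def)
  then show ?thesis using assms(2) by induction (auto intro: rot opp)
qed

text \<open>
  By connectedness any region is reached from any other by crossing arcs.
\<close>

lemma region_induct:
  assumes "d\<^sub>0 \<in> darts D" and "P (region_at D d\<^sub>0)"
    and step: "\<And>x. x \<in> darts D \<Longrightarrow> P (region_at D x) \<Longrightarrow> P (region_at D (opp D x))"
    and d: "d \<in> darts D"
  shows "P (region_at D d)"
proof (rule dart_induct[of d\<^sub>0 "\<lambda>x. P (region_at D x)"])
  fix x assume x: "x \<in> darts D" "P (region_at D x)"
  then show "P (region_at D (rot D x))"
    using step[of "opp D (rot D x)"] by (simp add: opp_opp)
qed (use assms in auto)

section \<open>Euler's formula and even sets of arcs\<close>

text \<open>
  The mod 2 boundary of a set of arcs: the crossings with an odd number of darts on these arcs.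
  Counting darts rather than arcs makes an arc with both ends at one crossing count twice.
\<close>

definition arc_boundary :: "'d set set \<Rightarrow> 'd set set" where
  "arc_boundary X = {c \<in> crossings D. odd (card {d \<in> c. {d, opp D d} \<in> X})}"

text \<open>
  The mod 2 coboundary of a set of regions: the arcs that separate it from its complement.
  The witness \<open>d\<close> is the dart of the arc whose corner lies in a region of \<open>Y\<close>.
\<close>

definition region_cut :: "'d set set \<Rightarrow> 'd set set" where
  "region_cut Y = {{d, opp D d} | d. d \<in> darts D \<and> region_at D d \<in> Y \<and> region_at D (opp D d) \<notin> Y}"

lemma finite_plane_arcs: "finite (plane_arcs D)" and finite_regions: "finite (regions D)"
  and finite_crossings: "finite (crossings D)"
  using finite_darts by (auto simp: plane_arcs_def regions_def crossings_def)

lemma finite_crossing: "c \<in> crossings D \<Longrightarrow> finite c"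
  using crossing_subset finite_darts by (auto simp: crossings_def intro: finite_subset)

lemma mem_region_cut:
  assumes "d \<in> darts D"
  shows "{d, opp D d} \<in> region_cut Y \<longleftrightarrow> (region_at D d \<in> Y) \<noteq> (region_at D (opp D d) \<in> Y)"
proof
  assume "{d, opp D d} \<in> region_cut Y"
  then show "(region_at D d \<in> Y) \<noteq> (region_at D (opp D d) \<in> Y)"
    by (auto simp: region_cut_def doubleton_eq_iff)
next
  assume *: "(region_at D d \<in> Y) \<noteq> (region_at D (opp D d) \<in> Y)"
  show "{d, opp D d} \<in> region_cut Y"
  proof (cases "region_at D d \<in> Y")
    case True
    with * assms show ?thesis unfolding region_cut_def by blast
  next
    case False
    have "{opp D d, opp D (opp D d)} \<in> region_cut Y"
      unfolding region_cut_def mem_Collect_eq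
      by (rule exI[of _ "opp D d"]) (use False * assms in \<open>simp add: opp_opp\<close>)
    then show ?thesis using assms by (simp add: opp_opp insert_commute)
  qed
qed

lemma region_cut_subset: "region_cut Y \<subseteq> plane_arcs D"
  by (auto simp: region_cut_def plane_arcs_def)

lemma plane_arcs_eqI:
  assumes "X \<subseteq> plane_arcs D" "X' \<subseteq> plane_arcs D"
    and "\<And>d. d \<in> darts D \<Longrightarrow> {d, opp D d} \<in> X \<longleftrightarrow> {d, opp D d} \<in> X'"
  shows "X = X'"
  using assms unfolding plane_arcs_def by blast

lemma region_cut_sym_diff: "region_cut (sym_diff Y Y') = sym_diff (region_cut Y) (region_cut Y')"
  by (rule plane_arcs_eqI) (use region_cut_subset in \<open>auto simp: mem_region_cut\<close>)

lemma arc_boundary_sym_diff: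
  "arc_boundary (sym_diff X X') = sym_diff (arc_boundary X) (arc_boundary X')"
proof -
  have "odd (card {d \<in> c. {d, opp D d} \<in> sym_diff X X'}) \<longleftrightarrow>
      odd (card {d \<in> c. {d, opp D d} \<in> X}) \<noteq> odd (card {d \<in> c. {d, opp D d} \<in> X'})"
    if "c \<in> crossings D" for c
  proof -
    have "{d \<in> c. {d, opp D d} \<in> sym_diff X X'} =
        sym_diff {d \<in> c. {d, opp D d} \<in> X} {d \<in> c. {d, opp D d} \<in> X'}" by auto
    then show ?thesis using finite_crossing[OF that] by (simp add: odd_card_sym_diff)
  qed
  then show ?thesis by (auto simp: arc_boundary_def)
qed

lemma arc_boundary_empty_iff:
  "arc_boundary X = {} \<longleftrightarrow> (\<forall>d\<in>darts D. let P = (\<lambda>x. {x, opp D x} \<in> X) in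
     (P d \<longleftrightarrow> P (rot D d)) \<longleftrightarrow> (P (rot D (rot D d)) \<longleftrightarrow> P (rot D (rot D (rot D d)))))"
proof -
  have "odd (card {x \<in> orbit (rot D) d. {x, opp D x} \<in> X}) \<longleftrightarrow> \<not> (let P = (\<lambda>x. {x, opp D x} \<in> X) in
     (P d \<longleftrightarrow> P (rot D d)) \<longleftrightarrow> (P (rot D (rot D d)) \<longleftrightarrow> P (rot D (rot D (rot D d)))))"
    if "d \<in> darts D" for d
    unfolding crossing_eq[OF that] Let_def
    by (subst odd_card_filter_4[OF distinct_crossing[OF that]]) blast
  then show ?thesis unfolding arc_boundary_def crossings_def by blast
qed

lemma arc_boundary_region_cut: "arc_boundary (region_cut Y) = {}"
  unfolding arc_boundary_empty_iff Let_def by (auto simp: mem_region_cut region_opp rot4)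

text \<open>
  Only the empty set and the set of all regions have no separating arc, by connectedness.
\<close>

lemma region_cut_kernel: "card {Y \<in> Pow (regions D). region_cut Y = {}} \<le> 2"
proof -
  have "Y \<in> {{}, regions D}" if Y: "Y \<subseteq> regions D" "region_cut Y = {}" for Y
  proof -
    have step: "region_at D x \<in> Y \<longleftrightarrow> region_at D (opp D x) \<in> Y" if "x \<in> darts D" for x
      using mem_region_cut[OF that, of Y] Y(2) by simp
    have "region_at D d \<in> Y \<longleftrightarrow> region_at D (outer D) \<in> Y" if "d \<in> darts D" for d
      using outer_in_darts _ _ that
      by (rule region_induct[where P = "\<lambda>R. R \<in> Y \<longleftrightarrow> region_at D (outer D) \<in> Y"])
        (simp_all only: step)
    then show ?thesis using Y unfolding regions_def by blast
  qed
  then have "{Y \<in> Pow (regions D). region_cut Y = {}} \<subseteq> {{}, regions D}" by blast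
  then have "card {Y \<in> Pow (regions D). region_cut Y = {}} \<le> card {{}, regions D}"
    by (intro card_mono) auto
  also have "\<dots> \<le> 2" by (simp add: card_insert_if)
  finally show ?thesis .
qed

lemma arc_boundary_single:
  assumes d: "d \<in> darts D"
  shows "arc_boundary {{d, opp D d}} = sym_diff {orbit (rot D) d} {orbit (rot D) (opp D d)}"
proof -
  have odd: "odd (card {x \<in> c. {x, opp D x} \<in> {{d, opp D d}}}) \<longleftrightarrow>
      (d \<in> c) \<noteq> (opp D d \<in> c)" if "c \<in> crossings D" for c
  proof -
    have "{x \<in> c. {x, opp D x} \<in> {{d, opp D d}}} = c \<inter> {d, opp D d}"
      using d opp_opp[OF d] by (auto simp: doubleton_eq_iff)
    also have "\<dots> = (if d \<in> c then {d} else {}) \<union> (if opp D d \<in> c then {opp D d} else {})" by auto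
    finally show ?thesis using opp_neq[OF d] by auto
  qed
  have mem: "x \<in> c \<longleftrightarrow> orbit (rot D) x = c" if "c \<in> crossings D" for c x
    using that crossing_eqI crossing_self unfolding crossings_def by blast
  have crossings: "orbit (rot D) d \<in> crossings D" "orbit (rot D) (opp D d) \<in> crossings D"
    using d by (simp_all add: crossings_def)
  show ?thesis
  proof (rule Set.set_eqI)
    fix c
    show "c \<in> arc_boundary {{d, opp D d}} \<longleftrightarrow>
        c \<in> sym_diff {orbit (rot D) d} {orbit (rot D) (opp D d)}"
    proof (cases "c \<in> crossings D")
      case True
      have "c \<in> arc_boundary {{d, opp D d}} \<longleftrightarrow> (d \<in> c) \<noteq> (opp D d \<in> c)"
        unfolding arc_boundary_def mem_Collect_eq odd[OF True] using True by blast
      then show ?thesis unfolding mem[OF True] by blast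
    next
      case False
      then show ?thesis using crossings unfolding arc_boundary_def by blast
    qed
  qed
qed

text \<open>
  Connectedness again: a path joins any crossing to a base crossing \<open>c\<^sub>0\<close>, so off \<open>c\<^sub>0\<close> the boundary
  of a set of arcs can be prescribed arbitrarily.
\<close>

lemma arc_boundary_image: "2 ^ (card (crossings D) - 1) \<le> card (arc_boundary ` Pow (plane_arcs D))"
proof -
  define c\<^sub>0 where "c\<^sub>0 = orbit (rot D) (outer D)"
  have path: "\<exists>X\<subseteq>plane_arcs D. arc_boundary X = sym_diff {c\<^sub>0} {orbit (rot D) d}" if "d \<in> darts D" for d
  proof (rule dart_induct[OF outer_in_darts _ _ _ that])
    have "arc_boundary {} = {}" by (simp add: arc_boundary_def)
    then show "\<exists>X\<subseteq>plane_arcs D. arc_boundary X = sym_diff {c\<^sub>0} {orbit (rot D) (outer D)}"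
      by (intro exI[of _ "{}"]) (simp add: c\<^sub>0_def)
  next
    fix x assume x: "x \<in> darts D" "\<exists>X\<subseteq>plane_arcs D. arc_boundary X = sym_diff {c\<^sub>0} {orbit (rot D) x}"
    then obtain X where X: "X \<subseteq> plane_arcs D" "arc_boundary X = sym_diff {c\<^sub>0} {orbit (rot D) x}" by blast
    have "{x, opp D x} \<in> plane_arcs D" using x by (auto simp: plane_arcs_def)
    then have "sym_diff X {{x, opp D x}} \<subseteq> plane_arcs D" using X by auto
    moreover have "arc_boundary (sym_diff X {{x, opp D x}}) = sym_diff {c\<^sub>0} {orbit (rot D) (opp D x)}"
      unfolding arc_boundary_sym_diff X arc_boundary_single[OF x(1)] by auto
    ultimately show "\<exists>X\<subseteq>plane_arcs D. arc_boundary X = sym_diff {c\<^sub>0} {orbit (rot D) (opp D x)}" by blast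
  qed simp
  have all: "\<exists>X\<subseteq>plane_arcs D. arc_boundary X - {c\<^sub>0} = S" if "S \<subseteq> crossings D - {c\<^sub>0}" for S
  proof -
    have "finite S" using that finite_crossings finite_subset by blast
    then show ?thesis using that
    proof (induction S)
      case empty
      have "arc_boundary {} = {}" by (simp add: arc_boundary_def)
      then show ?case by (intro exI[of _ "{}"]) simp
    next
      case (insert c S)
      then obtain X where X: "X \<subseteq> plane_arcs D" "arc_boundary X - {c\<^sub>0} = S" by auto
      from insert obtain d where "d \<in> darts D" "c = orbit (rot D) d" by (auto simp: crossings_def)
      then obtain X' where X': "X' \<subseteq> plane_arcs D" "arc_boundary X' = sym_diff {c\<^sub>0} {c}"
        using path by metis
      have "sym_diff X X' \<subseteq> plane_arcs D" using X X' by auto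
      moreover have "arc_boundary (sym_diff X X') - {c\<^sub>0} = insert c S"
        unfolding arc_boundary_sym_diff X' using X insert by auto
      ultimately show ?case by blast
    qed
  qed
  have "c\<^sub>0 \<in> crossings D" using outer_in_darts by (simp add: c\<^sub>0_def crossings_def)
  then have "2 ^ (card (crossings D) - 1) = card (Pow (crossings D - {c\<^sub>0}))"
    using finite_crossings by (simp add: card_Pow)
  also have "\<dots> \<le> card ((\<lambda>S. S - {c\<^sub>0}) ` arc_boundary ` Pow (plane_arcs D))"
  proof (rule card_mono)
    show "Pow (crossings D - {c\<^sub>0}) \<subseteq> (\<lambda>S. S - {c\<^sub>0}) ` arc_boundary ` Pow (plane_arcs D)"
    proof
      fix S assume "S \<in> Pow (crossings D - {c\<^sub>0})"
      then obtain X where "X \<subseteq> plane_arcs D" "arc_boundary X - {c\<^sub>0} = S" using all by blast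
      then show "S \<in> (\<lambda>S. S - {c\<^sub>0}) ` arc_boundary ` Pow (plane_arcs D)" by blast
    qed
  qed (use finite_plane_arcs in auto)
  also have "\<dots> \<le> card (arc_boundary ` Pow (plane_arcs D))"
    using finite_plane_arcs by (intro card_image_le) auto
  finally show ?thesis .
qed

text \<open>
  With \<open>V\<close>, \<open>E\<close>, \<open>F\<close> the numbers of crossings, arcs and regions, there are at most
  \<open>2\<^sup>E / 2\<^sup>V\<^sup>-\<^sup>1\<close> sets of arcs with empty boundary and at least \<open>2\<^sup>F / 2\<close> cuts. Each cut has empty boundary,
  and the two numbers agree because \<open>V + F = E + 2\<close>.
\<close>

lemma even_arc_set_is_region_cut:
  assumes "X \<subseteq> plane_arcs D" and "arc_boundary X = {}"
  shows "\<exists>Y\<subseteq>regions D. X = region_cut Y"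
proof -
  let ?K = "{X \<in> Pow (plane_arcs D). arc_boundary X = {}}"
  let ?I = "region_cut ` Pow (regions D)"
  define V E F where "V = card (crossings D)" and "E = card (plane_arcs D)" and "F = card (regions D)"
  have "V > 0" "F > 0"
    using finite_crossings finite_regions darts_nonempty
    by (auto simp: V_def F_def card_gt_0_iff crossings_def regions_def)
  with euler have E: "E = (V - 1) + (F - 1)" and F: "F = Suc (F - 1)"
    by (auto simp: V_def E_def F_def)
  have finK: "finite ?K" using finite_plane_arcs by auto
  have sub: "?I \<subseteq> ?K" using region_cut_subset arc_boundary_region_cut by auto
  have "card ?K * 2 ^ (V - 1) \<le> card ?K * card (arc_boundary ` Pow (plane_arcs D))"
    using arc_boundary_image by (simp add: V_def)
  also have "\<dots> = 2 ^ E"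
    unfolding E_def by (rule card_Pow_eq_kernel_times_image[symmetric])
      (auto simp: finite_plane_arcs arc_boundary_sym_diff)
  also have "\<dots> = 2 ^ (F - 1) * 2 ^ (V - 1)" unfolding E by (simp add: power_add)
  finally have K: "card ?K \<le> 2 ^ (F - 1)" by simp
  have "2 * 2 ^ (F - 1) = (2::nat) ^ F" by (subst (2) F) simp
  also have "\<dots> = card {Y \<in> Pow (regions D). region_cut Y = {}} * card ?I"
    unfolding F_def by (rule card_Pow_eq_kernel_times_image)
      (auto simp: finite_regions region_cut_sym_diff)
  also have "\<dots> \<le> 2 * card ?I" using region_cut_kernel by simp
  finally have "card ?K \<le> card ?I" using K by simp
  then have IK: "?I = ?K" by (rule card_seteq[OF finK sub])
  from assms have "X \<in> ?K" by simp
  then have "X \<in> ?I" unfolding IK .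
  then obtain Y where "X = region_cut Y" "Y \<in> Pow (regions D)" by (rule imageE)
  then show ?thesis by blast
qed

section \<open>Seifert circles separate the plane\<close>

lemma darts_incoming: "darts D \<inter> incoming D = incoming D"
  using incoming_subset by blast

lemma incoming_dart: "d \<in> incoming D \<Longrightarrow> d \<in> darts D"
  using incoming_subset by blast

lemma seifert_next_incoming: "d \<in> incoming D \<Longrightarrow> seifert_next D d \<in> incoming D"
  using incoming_dart by (simp add: seifert_next_def incoming_opp incoming_rot2)

lemma inj_on_seifert_next: "inj_on (seifert_next D) (incoming D)"
proof (rule inj_onI)
  fix x y assume x: "x \<in> incoming D" and y: "y \<in> incoming D"
    and eq: "seifert_next D x = seifert_next D y"
  define t where "t d = (if rot D d \<in> incoming D then rot D (rot D (rot D d)) else rot D d)" for d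
  have inj: "a = b" if "rot D a = rot D b" for a b
    using that permutes_inj[OF rot_permutes] by (auto dest: injD)
  have "opp D (t x) = opp D (t y)" using eq by (simp add: t_def seifert_next_def)
  then have t: "t x = t y" using permutes_inj[OF opp_permutes] by (auto dest: injD)
  have mixed: False if "a \<in> incoming D" "b \<in> incoming D" "rot D (rot D (rot D a)) = rot D b" for a b
    using inj[OF that(3)] that incoming_rot2 incoming_dart by metis
  show "x = y"
  proof (cases "rot D x \<in> incoming D"; cases "rot D y \<in> incoming D")
    assume "rot D x \<in> incoming D" "rot D y \<in> incoming D"
    then show ?thesis using t inj by (simp add: t_def)
  next
    assume "rot D x \<in> incoming D" "rot D y \<notin> incoming D"
    then show ?thesis using t mixed[OF x y] by (simp add: t_def)
  next
    assume "rot D x \<notin> incoming D" "rot D y \<in> incoming D"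
    then show ?thesis using t mixed[OF y x] by (simp add: t_def)
  next
    assume "rot D x \<notin> incoming D" "rot D y \<notin> incoming D"
    then show ?thesis using t inj by (simp add: t_def)
  qed
qed

text \<open>
  The map \<open>seifert_next\<close> permutes only the incoming darts, so it is made the identity on the other
  elements of the type before facts about orbits of permutations are applied.
\<close>

lemma seifert_orbit:
  assumes d: "d \<in> incoming D"
  shows "d \<in> orbit (seifert_next D) d"
    and "cyclic_on (seifert_next D) (orbit (seifert_next D) d)"
    and "orbit (seifert_next D) d \<subseteq> incoming D"
proof -
  let ?s = "seifert_next D"
  define g where "g x = (if x \<in> incoming D then ?s x else x)" for x
  have fin: "finite (incoming D)" using incoming_subset finite_darts finite_subset by blast
  have "?s ` incoming D \<subseteq> incoming D" using seifert_next_incoming by blast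
  then have "?s ` incoming D = incoming D"
    using fin endo_inj_surj inj_on_seifert_next by blast
  then have "bij_betw g (incoming D) (incoming D)"
    using inj_on_seifert_next by (simp add: g_def bij_betw_def inj_on_def cong: image_cong_simp)
  then have g: "g permutes incoming D"
    by (rule bij_imp_permutes) (simp add: g_def)
  then have "permutation g" using fin unfolding permutation_permutes by blast
  then have self: "d \<in> orbit g d" by (rule permutation_self_in_orbit)
  have sub: "orbit g d \<subseteq> incoming D" by (rule permutes_orbit_subset[OF g d])
  have eq: "orbit ?s d = orbit g d"
    by (rule orbit_cong[OF self]) (use sub in \<open>auto simp: g_def\<close>)
  show "d \<in> orbit ?s d" "orbit ?s d \<subseteq> incoming D" using eq self sub by simp_all
  have "cyclic_on g (orbit g d)" by (rule cyclic_on_orbit[OF g fin])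
  then show "cyclic_on ?s (orbit ?s d)"
    unfolding eq by (subst cyclic_cong[of _ _ g]) (use sub in \<open>auto simp: g_def\<close>)
qed

lemma seifert_circle_of_dart: "d \<in> incoming D \<Longrightarrow> orbit (seifert_next D) d \<in> seifert_circles D"
  unfolding seifert_circles_def darts_incoming by (rule imageI)

lemma seifert_circleD:
  assumes "C \<in> seifert_circles D"
  shows "C \<noteq> {}" and "C \<subseteq> incoming D" and "d \<in> C \<Longrightarrow> orbit (seifert_next D) d = C"
    and "d \<in> incoming D \<Longrightarrow> seifert_next D d \<in> C \<longleftrightarrow> d \<in> C"
proof -
  obtain x where x: "x \<in> incoming D" "C = orbit (seifert_next D) x"
    using assms by (auto simp: seifert_circles_def)
  then have cyc: "cyclic_on (seifert_next D) C" using seifert_orbit by blast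
  show "C \<noteq> {}" and "C \<subseteq> incoming D" using x seifert_orbit by blast+
  show eq: "orbit (seifert_next D) d = C" if "d \<in> C" for d
    by (rule orbit_cyclic_eq3[OF cyc that])
  show "seifert_next D d \<in> C \<longleftrightarrow> d \<in> C" if d: "d \<in> incoming D"
  proof
    assume "d \<in> C" then show "seifert_next D d \<in> C" by (rule cyclic_on_inI[OF cyc])
  next
    assume "seifert_next D d \<in> C"
    then have "C = orbit (seifert_next D) (seifert_next D d)" using eq by simp
    also have "\<dots> = orbit (seifert_next D) d"
      by (rule self_in_orbit_step) (rule seifert_orbit(1)[OF d])
    finally show "d \<in> C" using seifert_orbit(1)[OF d] by simp
  qed
qed

lemma seifert_circles_disjoint:
  assumes "C \<in> seifert_circles D" "C' \<in> seifert_circles D" "d \<in> C" "d \<in> C'"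
  shows "C = C'"
  using assms seifert_circleD(3) by blast

text \<open>
  The arc through the dart \<open>d\<close> belongs to the Seifert circle \<open>C\<close>. Of the two darts of an arc, \<open>C\<close>
  contains at most the incoming one.
\<close>

definition on_circle :: "'d set \<Rightarrow> 'd \<Rightarrow> bool" where
  "on_circle C d \<longleftrightarrow> d \<in> C \<or> opp D d \<in> C"

lemma on_circle_opp: "d \<in> darts D \<Longrightarrow> on_circle C (opp D d) \<longleftrightarrow> on_circle C d"
  by (auto simp: on_circle_def opp_opp)

lemma on_circle_iff:
  assumes "C \<in> seifert_circles D" and "d \<in> darts D"
  shows "on_circle C d \<longleftrightarrow> (if d \<in> incoming D then d \<in> C else opp D d \<in> C)"
  using assms seifert_circleD(2) incoming_opp unfolding on_circle_def by (metis subsetD)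

lemma coherent_rot2: "d \<in> darts D \<Longrightarrow> coherent_corner D (rot D (rot D d)) \<longleftrightarrow> coherent_corner D d"
  by (auto simp: coherent_corner_def incoming_rot2)

lemma coherent_rot: "d \<in> darts D \<Longrightarrow> coherent_corner D (rot D d) \<longleftrightarrow> \<not> coherent_corner D d"
  by (auto simp: coherent_corner_def incoming_rot2)

text \<open>
  A statement about coherent corners may be proved for corners between two incoming arcs, provided
  that it carries over to the opposite corner.
\<close>

lemma coherent_wlog [consumes 2, case_names incoming rot2]:
  assumes "d \<in> darts D" and "coherent_corner D d"
    and inc: "\<And>a. a \<in> incoming D \<Longrightarrow> rot D a \<in> incoming D \<Longrightarrow> P a"
    and rot2: "\<And>a. a \<in> darts D \<Longrightarrow> coherent_corner D a \<Longrightarrow> P (rot D (rot D a)) \<Longrightarrow> P a"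
  shows "P d"
proof (cases "d \<in> incoming D")
  case True
  then show ?thesis using assms by (auto simp: coherent_corner_def)
next
  case False
  then have "P (rot D (rot D d))"
    using assms(1,2) by (intro inc) (auto simp: coherent_corner_def incoming_rot2)
  then show ?thesis using rot2 assms(1,2) by blast
qed

text \<open>
  The smoothing at a crossing reconnects the four darts in two pairs, each bounding an incoherent
  corner; a Seifert circle contains both arcs of a pair or none.
\<close>

lemma on_circle_smoothing:
  assumes C: "C \<in> seifert_circles D" and "d \<in> darts D" and "coherent_corner D d"
  shows "(on_circle C d \<longleftrightarrow> on_circle C (rot D (rot D (rot D d)))) \<and>
    (on_circle C (rot D d) \<longleftrightarrow> on_circle C (rot D (rot D d)))"
  using assms(2,3)
proof (induction rule: coherent_wlog)
  case (incoming a)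
  then have darts: "a \<in> darts D" using incoming_dart by blast
  have "on_circle C a \<longleftrightarrow> seifert_next D a \<in> C"
    using C darts incoming by (simp add: on_circle_iff seifert_circleD(4))
  also have "\<dots> \<longleftrightarrow> on_circle C (rot D (rot D (rot D a)))"
    using C darts incoming by (simp add: on_circle_iff incoming_rot2 seifert_next_def)
  finally have 1: "on_circle C a \<longleftrightarrow> on_circle C (rot D (rot D (rot D a)))" .
  have "on_circle C (rot D a) \<longleftrightarrow> seifert_next D (rot D a) \<in> C"
    using C darts incoming by (simp add: on_circle_iff seifert_circleD(4))
  also have "\<dots> \<longleftrightarrow> on_circle C (rot D (rot D a))"
    using C darts incoming by (simp add: on_circle_iff incoming_rot2 seifert_next_def)
  finally show ?case using 1 by blast
next
  case (rot2 a)
  then show ?case by (simp add: rot4)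
qed

lemma seifert_circle_is_region_cut:
  assumes C: "C \<in> seifert_circles D"
  shows "\<exists>Y\<subseteq>regions D. \<forall>d\<in>darts D.
    (region_at D d \<in> Y) \<noteq> (region_at D (opp D d) \<in> Y) \<longleftrightarrow> on_circle C d"
proof -
  define X where "X = {{d, opp D d} | d. d \<in> darts D \<and> on_circle C d}"
  have X: "{d, opp D d} \<in> X \<longleftrightarrow> on_circle C d" if d: "d \<in> darts D" for d
  proof
    assume "{d, opp D d} \<in> X"
    then obtain x where x: "x \<in> darts D" "on_circle C x" "{d, opp D d} = {x, opp D x}"
      unfolding X_def by blast
    then have "d = x \<or> d = opp D x" by (auto simp: doubleton_eq_iff)
    then show "on_circle C d" using x on_circle_opp by auto
  qed (use d X_def in blast)
  have bal: "(on_circle C d \<longleftrightarrow> on_circle C (rot D d)) \<longleftrightarrow>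
      (on_circle C (rot D (rot D d)) \<longleftrightarrow> on_circle C (rot D (rot D (rot D d))))"
    if d: "d \<in> darts D" for d
  proof (cases "coherent_corner D d")
    case True
    then show ?thesis using on_circle_smoothing[OF C d] by blast
  next
    case False
    then have "coherent_corner D (rot D d)" using coherent_rot d by blast
    then show ?thesis using on_circle_smoothing[OF C, of "rot D d"] d by (simp add: rot4)
  qed
  have "arc_boundary X = {}"
    unfolding arc_boundary_empty_iff Let_def
  proof
    fix d assume d: "d \<in> darts D"
    then show "({d, opp D d} \<in> X) = ({rot D d, opp D (rot D d)} \<in> X) \<longleftrightarrow>
        ({rot D (rot D d), opp D (rot D (rot D d))} \<in> X) =
        ({rot D (rot D (rot D d)), opp D (rot D (rot D (rot D d)))} \<in> X)"
      using bal[OF d] by (simp only: X rot_in_darts)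
  qed
  moreover have "X \<subseteq> plane_arcs D" unfolding X_def plane_arcs_def by blast
  ultimately obtain Y where Y: "Y \<subseteq> regions D" "X = region_cut Y"
    using even_arc_set_is_region_cut by blast
  have "(region_at D d \<in> Y) \<noteq> (region_at D (opp D d) \<in> Y) \<longleftrightarrow> on_circle C d" if "d \<in> darts D" for d
    using mem_region_cut[OF that, of Y] X[OF that] Y(2) by simp
  then show ?thesis using Y(1) by blast
qed

text \<open>
  Two regions lie in the same component of the complement of \<open>C\<close>.
\<close>

abbreviation connected_off :: "'d set \<Rightarrow> 'd set \<Rightarrow> 'd set \<Rightarrow> bool" where
  "connected_off C R R' \<equiv> (R, R') \<in> (adjacent_off D C)\<^sup>*"

lemma connected_off_opp:
  assumes "d \<in> darts D" and "\<not> on_circle C d"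
  shows "connected_off C (region_at D d) (region_at D (opp D d))"
  using assms unfolding adjacent_off_def on_circle_def by blast

lemma connected_off_rot2:
  assumes "d \<in> darts D" and "coherent_corner D d"
  shows "connected_off C (region_at D d) (region_at D (rot D (rot D d)))"
  using assms unfolding adjacent_off_def by blast

lemma sym_adjacent_off: "sym (adjacent_off D C)"
proof (rule symI)
  fix R R' assume "(R, R') \<in> adjacent_off D C"
  then consider d where "d \<in> darts D" "d \<notin> C" "opp D d \<notin> C" "R = region_at D d" "R' = region_at D (opp D d)"
    | d where "d \<in> darts D" "coherent_corner D d" "R = region_at D d" "R' = region_at D (rot D (rot D d))"
    unfolding adjacent_off_def by blast
  then show "(R', R) \<in> adjacent_off D C"
  proof cases
    case 1
    then have "\<exists>x. (R', R) = (region_at D x, region_at D (opp D x)) \<and> x \<in> darts D \<and> x \<notin> C \<and> opp D x \<notin> C"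
      by (intro exI[of _ "opp D d"]) (simp add: opp_opp)
    then show ?thesis unfolding adjacent_off_def by blast
  next
    case 2
    then have "\<exists>x. (R', R) = (region_at D x, region_at D (rot D (rot D x))) \<and> x \<in> darts D \<and> coherent_corner D x"
      by (intro exI[of _ "rot D (rot D d)"]) (simp add: rot4 coherent_rot2)
    then show ?thesis unfolding adjacent_off_def by blast
  qed
qed

lemma connected_off_sym: "connected_off C R R' \<Longrightarrow> connected_off C R' R"
  using sym_rtrancl[OF sym_adjacent_off] by (rule symD)

lemma connected_off_same_side:
  assumes Y: "\<And>d. d \<in> darts D \<Longrightarrow>
      (region_at D d \<in> Y) \<noteq> (region_at D (opp D d) \<in> Y) \<longleftrightarrow> on_circle C d"
    and C: "C \<in> seifert_circles D" and "connected_off C R R'"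
  shows "R \<in> Y \<longleftrightarrow> R' \<in> Y"
  using assms(3)
proof induction
  case (step R\<^sub>1 R\<^sub>2)
  consider d where "d \<in> darts D" "\<not> on_circle C d" "R\<^sub>1 = region_at D d" "R\<^sub>2 = region_at D (opp D d)"
    | d where "d \<in> darts D" "coherent_corner D d" "R\<^sub>1 = region_at D d" "R\<^sub>2 = region_at D (rot D (rot D d))"
    using step(2) unfolding adjacent_off_def on_circle_def by blast
  then have "R\<^sub>1 \<in> Y \<longleftrightarrow> R\<^sub>2 \<in> Y"
  proof cases
    case 1
    then show ?thesis using Y by blast
  next
    case 2
    have "on_circle C (rot D d) \<longleftrightarrow> on_circle C (rot D (rot D d))"
      using on_circle_smoothing[OF C] 2 by blast
    then show ?thesis
      using Y[of "rot D d"] Y[of "rot D (rot D d)"] 2 by simp blast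
  qed
  then show ?case using step by blast
qed simp

text \<open>
  One side of the circle stays in the same region at a smoothing, while the other side passes
  through the gap to the opposite coherent corner. This gap is open for every \<open>C\<close>, so \<open>C\<close> need not
  be the circle that is followed.
\<close>

lemma seifert_next_sides:
  assumes d: "d \<in> incoming D"
  shows "connected_off C (region_at D d) (region_at D (seifert_next D d)) \<and>
    connected_off C (region_at D (opp D d)) (region_at D (opp D (seifert_next D d)))"
proof -
  have dd: "d \<in> darts D" using d incoming_dart by blast
  show ?thesis
  proof (cases "rot D d \<in> incoming D")
    case True
    then have "coherent_corner D d" using d by (simp add: coherent_corner_def)
    then show ?thesis
      using connected_off_rot2[OF dd] True dd by (simp add: seifert_next_def opp_opp region_opp[of d])
  next
    case False
    then have "coherent_corner D (rot D (rot D (rot D d)))"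
      using d dd by (simp add: coherent_corner_def incoming_rot2 rot4)
    from connected_off_rot2[OF _ this, of C]
    show ?thesis
      using False dd by (simp add: seifert_next_def opp_opp region_opp[of d] rot4)
  qed
qed

lemma seifert_circle_sides:
  assumes "C \<in> seifert_circles D" "d \<in> C" "d' \<in> C"
  shows "connected_off C' (region_at D d) (region_at D d') \<and>
    connected_off C' (region_at D (opp D d)) (region_at D (opp D d'))"
proof -
  have d: "d \<in> incoming D" using assms seifert_circleD(2) by blast
  have "d' \<in> orbit (seifert_next D) d" using assms seifert_circleD(3) by blast
  then show ?thesis
  proof induction
    case base
    then show ?case using seifert_next_sides[OF d] .
  next
    case (step x)
    then have "x \<in> incoming D" using seifert_orbit(3)[OF d] by blast
    from seifert_next_sides[OF this] step.IH show ?case by (meson rtrancl_trans)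
  qed
qed

text \<open>
  A circle has at most two complementary components, those of its two sides.
\<close>

lemma connected_off_cover:
  assumes C: "C \<in> seifert_circles D" and d: "d \<in> C" and x: "x \<in> darts D"
  shows "connected_off C (region_at D d) (region_at D x) \<or>
    connected_off C (region_at D (opp D d)) (region_at D x)"
proof -
  have dd: "d \<in> darts D" using C d seifert_circleD(2) incoming_dart by blast
  show ?thesis
  proof (rule region_induct[OF dd _ _ x])
    fix y assume y: "y \<in> darts D" and IH: "connected_off C (region_at D d) (region_at D y) \<or>
      connected_off C (region_at D (opp D d)) (region_at D y)"
    show "connected_off C (region_at D d) (region_at D (opp D y)) \<or>
      connected_off C (region_at D (opp D d)) (region_at D (opp D y))"
    proof (cases "on_circle C y")
      case True
      then show ?thesis
        using seifert_circle_sides[OF C d] opp_opp[OF y] unfolding on_circle_def by metis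
    next
      case False
      then show ?thesis using connected_off_opp[OF y False] IH by (meson rtrancl_trans)
    qed
  qed simp
qed

lemma seifert_disk_iff:
  "d \<in> darts D \<Longrightarrow> region_at D d \<in> seifert_disk D C \<longleftrightarrow>
    \<not> connected_off C (region_at D (outer D)) (region_at D d)"
  by (simp add: seifert_disk_def)

lemma seifert_disk_connected:
  assumes "connected_off C (region_at D x) (region_at D y)" "x \<in> darts D" "y \<in> darts D"
  shows "region_at D x \<in> seifert_disk D C \<longleftrightarrow> region_at D y \<in> seifert_disk D C"
  using assms connected_off_sym[OF assms(1)] by (simp add: seifert_disk_iff) (meson rtrancl_trans)

text \<open>
  The Jordan curve theorem for a Seifert circle: exactly one of its sides is in its disk.
\<close>

lemma seifert_circle_separates:
  assumes C: "C \<in> seifert_circles D" and d: "d \<in> C"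
  shows "region_at D d \<in> seifert_disk D C \<longleftrightarrow> region_at D (opp D d) \<notin> seifert_disk D C"
proof -
  have di: "d \<in> incoming D" using C d seifert_circleD(2) by blast
  then have dd: "d \<in> darts D" by (rule incoming_dart)
  obtain Y where Y: "\<And>x. x \<in> darts D \<Longrightarrow>
      (region_at D x \<in> Y) \<noteq> (region_at D (opp D x) \<in> Y) \<longleftrightarrow> on_circle C x"
    using seifert_circle_is_region_cut[OF C] by blast
  have "on_circle C d" using d by (simp add: on_circle_def)
  then have sep: "\<not> connected_off C (region_at D d) (region_at D (opp D d))"
    using connected_off_same_side[OF Y C] Y[OF dd] by blast
  consider "connected_off C (region_at D d) (region_at D (outer D))"
    | "connected_off C (region_at D (opp D d)) (region_at D (outer D))"
    using connected_off_cover[OF C d outer_in_darts] by blast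
  then show ?thesis
    using sep dd connected_off_sym
    by (cases; simp add: seifert_disk_iff) (meson rtrancl_trans)+
qed

section \<open>The shading of a special diagram\<close>

text \<open>
  Membership in the disk of one circle is constant along another circle. If \<open>C\<close> lies inside the disk
  of \<open>C'\<close>, and \<open>t\<close> tells whether \<open>C'\<close> lies inside the disk of \<open>C\<close>, then no region is outside the disk of
  \<open>C'\<close> with membership in the disk of \<open>C\<close> different from \<open>t\<close>: such regions could not be left by
  crossing an arc. The unbounded region shows that \<open>t\<close> is false, and then the disk of \<open>C\<close> is
  contained in that of \<open>C'\<close>.
\<close>

lemma seifert_circle_outside_other_disks:
  assumes special: "special_diagram D"
    and C: "C \<in> seifert_circles D" and C': "C' \<in> seifert_circles D" and neq: "C \<noteq> C'" and d: "d \<in> C"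
  shows "region_at D d \<notin> seifert_disk D C' \<and> region_at D (opp D d) \<notin> seifert_disk D C'"
proof -
  let ?in = "\<lambda>C x. region_at D x \<in> seifert_disk D C"
  have const: "(?in B x \<longleftrightarrow> ?in B y) \<and> (?in B (opp D x) \<longleftrightarrow> ?in B y)"
    if A: "A \<in> seifert_circles D" and B: "B \<in> seifert_circles D" and AB: "A \<noteq> B"
      and x: "x \<in> A" and y: "y \<in> A" for A B x y
  proof -
    have inc: "x \<in> incoming D" "y \<in> incoming D" using A x y seifert_circleD(2) by blast+
    then have darts: "x \<in> darts D" "y \<in> darts D" by (auto intro: incoming_dart)
    have "x \<notin> B" using seifert_circles_disjoint[OF A B x] AB by blast
    then have "\<not> on_circle B x" using on_circle_iff[OF B darts(1)] inc by simp
    then have "?in B x \<longleftrightarrow> ?in B (opp D x)"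
      using seifert_disk_connected[OF connected_off_opp] darts by simp
    moreover have "?in B x \<longleftrightarrow> ?in B y"
      using seifert_disk_connected seifert_circle_sides[OF A x y] darts by blast
    ultimately show ?thesis by blast
  qed
  have "\<not> ?in C' d"
  proof
    assume s: "?in C' d"
    obtain d' where d': "d' \<in> C'" using seifert_circleD(1)[OF C'] by blast
    define Q where "Q R \<longleftrightarrow> (R \<in> seifert_disk D C \<longleftrightarrow> ?in C d') \<or> R \<in> seifert_disk D C'" for R
    have dd: "d \<in> darts D" using C d seifert_circleD(2) incoming_dart by blast
    have Q: "Q (region_at D x)" if "x \<in> darts D" for x
    proof (rule region_induct[OF dd _ _ that])
      show "Q (region_at D d)" using s by (simp add: Q_def)
    next
      fix y assume y: "y \<in> darts D" and IH: "Q (region_at D y)"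
      consider (C) "on_circle C y" | (C') "on_circle C' y"
        | (off) "\<not> on_circle C y" "\<not> on_circle C' y" by blast
      then show "Q (region_at D (opp D y))"
      proof cases
        case C
        then have "?in C' (opp D y)"
          using const[OF \<open>C \<in> seifert_circles D\<close> \<open>C' \<in> seifert_circles D\<close> neq _ d] s opp_opp[OF y]
          unfolding on_circle_def by metis
        then show ?thesis by (simp add: Q_def)
      next
        case C'
        then have "?in C (opp D y) \<longleftrightarrow> ?in C d'"
          using const[OF \<open>C' \<in> seifert_circles D\<close> C neq[symmetric] _ d'] opp_opp[OF y]
          unfolding on_circle_def by metis
        then show ?thesis by (simp add: Q_def)
      next
        case off
        then show ?thesis
          using seifert_disk_connected[OF connected_off_opp[OF y]] y IH by (simp add: Q_def)
      qed
    qed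
    have outer: "\<not> ?in B (outer D)" for B
      using outer_in_darts by (simp add: seifert_disk_iff)
    have "\<not> ?in C d'" using Q[OF outer_in_darts] outer unfolding Q_def by blast
    then have "?in C x \<Longrightarrow> ?in C' x" if "x \<in> darts D" for x
      using Q[OF that] unfolding Q_def by blast
    then have "seifert_disk D C \<subseteq> seifert_disk D C'"
      unfolding seifert_disk_def regions_def by blast
    then show False using special C C' neq unfolding special_diagram_def by blast
  qed
  moreover have "?in C' (opp D d) \<longleftrightarrow> ?in C' d" using const[OF C C' neq d d] by blast
  ultimately show ?thesis by blast
qed

text \<open>
  Both strands at a coherent corner \<open>a\<close> between incoming arcs run along it, one with the corner on its
  right and one with the corner on its left. A single circle cannot have the same region on both
  sides.
\<close>

lemma crossing_joins_distinct_seifert_circles: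
  assumes a: "a \<in> incoming D" and b: "rot D a \<in> incoming D"
  shows "orbit (seifert_next D) a \<noteq> orbit (seifert_next D) (rot D a)"
proof
  let ?C = "orbit (seifert_next D) a"
  assume eq: "?C = orbit (seifert_next D) (rot D a)"
  have C: "?C \<in> seifert_circles D" using seifert_circle_of_dart[OF a] .
  have aC: "a \<in> ?C" using seifert_orbit(1)[OF a] .
  have bC: "rot D a \<in> ?C" using seifert_orbit(1)[OF b] eq by simp
  have "region_at D a \<in> seifert_disk D ?C \<longleftrightarrow> region_at D (rot D a) \<in> seifert_disk D ?C"
    using seifert_disk_connected seifert_circle_sides[OF C aC bC] a b incoming_dart by blast
  then show False using seifert_circle_separates[OF C bC] by simp
qed

lemma coherent_corner_unshaded:
  assumes special: "special_diagram D" and "d \<in> darts D" and "coherent_corner D d"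
    and C: "C \<in> seifert_circles D"
  shows "region_at D d \<notin> seifert_disk D C"
  using assms(2,3)
proof (induction rule: coherent_wlog)
  case (incoming a)
  let ?A = "orbit (seifert_next D) a" and ?B = "orbit (seifert_next D) (rot D a)"
  note disjoint = seifert_circle_outside_other_disks[OF special]
  show ?case
  proof (cases "C = ?A")
    case True
    then have "?B \<noteq> C" using crossing_joins_distinct_seifert_circles[OF incoming] by blast
    then show ?thesis
      using disjoint[OF seifert_circle_of_dart[OF incoming(2)] C _ seifert_orbit(1)[OF incoming(2)]] by simp
  next
    case False
    then show ?thesis
      using disjoint[OF seifert_circle_of_dart[OF incoming(1)] C _ seifert_orbit(1)[OF incoming(1)]] by blast
  qed
next
  case (rot2 a)
  then show ?case using seifert_disk_connected[OF connected_off_rot2] by simp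
qed

lemma incoherent_corner_shaded:
  assumes special: "special_diagram D" and d: "d \<in> darts D" and "\<not> coherent_corner D d"
  shows "\<exists>C\<in>seifert_circles D. region_at D d \<in> seifert_disk D C"
proof (cases "d \<in> incoming D")
  case True
  let ?C = "orbit (seifert_next D) d"
  have C: "?C \<in> seifert_circles D" and dC: "d \<in> ?C"
    using seifert_circle_of_dart[OF True] seifert_orbit(1)[OF True] .
  have "coherent_corner D (rot D (rot D (rot D d)))"
    using assms coherent_rot2 coherent_rot by simp
  then have "region_at D (opp D d) \<notin> seifert_disk D ?C"
    using coherent_corner_unshaded[OF special _ _ C] d by (simp add: region_opp[of d])
  then show ?thesis using seifert_circle_separates[OF C dC] C by blast
next
  case False
  then have a: "rot D d \<in> incoming D" using assms by (simp add: coherent_corner_def)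
  let ?C = "orbit (seifert_next D) (rot D d)"
  have C: "?C \<in> seifert_circles D" and dC: "rot D d \<in> ?C"
    using seifert_circle_of_dart[OF a] seifert_orbit(1)[OF a] .
  have "coherent_corner D (rot D d)" using assms coherent_rot by blast
  then have "region_at D (rot D d) \<notin> seifert_disk D ?C"
    using coherent_corner_unshaded[OF special _ _ C] d by simp
  then have "region_at D d \<in> seifert_disk D ?C" using seifert_circle_separates[OF C dC] by simp
  then show ?thesis using C by blast
qed

lemma coherent_iff_unshaded:
  assumes "special_diagram D" and "d \<in> darts D"
  shows "coherent_corner D d \<longleftrightarrow> region_at D d \<in> unshaded_regions D"
  using coherent_corner_unshaded[OF assms] incoherent_corner_shaded[OF assms] assms(2)
  unfolding unshaded_regions_def by auto

text \<open>
  Coherence is constant on the corners of a region.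
\<close>

lemma coherent_opp_rot:
  assumes "special_diagram D" and "d \<in> darts D"
  shows "coherent_corner D (opp D (rot D d)) \<longleftrightarrow> coherent_corner D d"
  using coherent_iff_unshaded assms by simp

section \<open>The Tait graph of a special alternating diagram\<close>

lemma coherent_incoming_exists:
  assumes "d \<in> darts D"
  obtains a where "a \<in> orbit (rot D) d" "a \<in> incoming D" "rot D a \<in> incoming D"
proof -
  have "\<exists>a\<in>{d, rot D d, rot D (rot D d), rot D (rot D (rot D d))}. a \<in> incoming D \<and> rot D a \<in> incoming D"
    using assms by (auto simp: incoming_rot2 rot4)
  then show ?thesis using that unfolding crossing_eq[OF assms] by blast
qed

lemma tail_corner_eq:
  assumes a: "a \<in> incoming D" and b: "rot D a \<in> incoming D"
  shows "tail_corner D (orbit (rot D) a) = (if a \<in> over D then a else rot D (rot D a))"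
    and "positive_crossing D (orbit (rot D) a) \<longleftrightarrow> a \<in> over D"
proof -
  have d: "a \<in> darts D" using a by (rule incoming_dart)
  have over_in: "over_in D (orbit (rot D) a) = (if a \<in> over D then a else rot D a)"
    unfolding over_in_def crossing_eq[OF d]
    by (rule the_equality) (use a b d in \<open>auto simp: incoming_rot2 over_rot split: if_splits\<close>)
  show "tail_corner D (orbit (rot D) a) = (if a \<in> over D then a else rot D (rot D a))"
    unfolding tail_corner_def over_in Let_def
    using a b d by (auto simp: coherent_corner_def incoming_rot2)
  show "positive_crossing D (orbit (rot D) a) \<longleftrightarrow> a \<in> over D"
    unfolding positive_crossing_def over_in using a b d by (auto simp: incoming_rot2)
qed

text \<open>
  Coherence, direction and over/under status of a dart determine whether its corner is the tail or
  the head of the edge through its crossing, and the sign of the crossing.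
\<close>

lemma tail_corner_iff:
  assumes d: "d \<in> darts D"
  shows "tail_corner D (orbit (rot D) d) = d \<longleftrightarrow>
      coherent_corner D d \<and> (d \<in> incoming D \<longleftrightarrow> d \<in> over D)"
    and "rot D (rot D (tail_corner D (orbit (rot D) d))) = d \<longleftrightarrow>
      coherent_corner D d \<and> (d \<in> incoming D \<longleftrightarrow> d \<notin> over D)"
    and "coherent_corner D d \<Longrightarrow> positive_crossing D (orbit (rot D) d) \<longleftrightarrow> d \<in> over D"
proof -
  obtain a where a: "a \<in> orbit (rot D) d" "a \<in> incoming D" "rot D a \<in> incoming D"
    using coherent_incoming_exists[OF d] .
  have eq: "orbit (rot D) d = orbit (rot D) a" using crossing_eqI[OF a(1)] by simp
  have da: "a \<in> darts D" using a(2) by (rule incoming_dart)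
  have "d \<in> orbit (rot D) a" using crossing_self eq by metis
  then consider "d = a" | "d = rot D a" | "d = rot D (rot D a)" | "d = rot D (rot D (rot D a))"
    unfolding crossing_eq[OF da] by blast
  then have "(tail_corner D (orbit (rot D) d) = d \<longleftrightarrow>
      coherent_corner D d \<and> (d \<in> incoming D \<longleftrightarrow> d \<in> over D)) \<and>
    (rot D (rot D (tail_corner D (orbit (rot D) d))) = d \<longleftrightarrow>
      coherent_corner D d \<and> (d \<in> incoming D \<longleftrightarrow> d \<notin> over D)) \<and>
    (coherent_corner D d \<longrightarrow> (positive_crossing D (orbit (rot D) d) \<longleftrightarrow> d \<in> over D))"
    unfolding eq tail_corner_eq[OF a(2,3)]
    using distinct_crossing[OF da] a(2,3) da
    by cases (simp_all add: coherent_corner_def incoming_rot2 over_rot rot4, (metis+)?)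
  then show "tail_corner D (orbit (rot D) d) = d \<longleftrightarrow>
      coherent_corner D d \<and> (d \<in> incoming D \<longleftrightarrow> d \<in> over D)"
    and "rot D (rot D (tail_corner D (orbit (rot D) d))) = d \<longleftrightarrow>
      coherent_corner D d \<and> (d \<in> incoming D \<longleftrightarrow> d \<notin> over D)"
    and "coherent_corner D d \<Longrightarrow> positive_crossing D (orbit (rot D) d) \<longleftrightarrow> d \<in> over D"
    by blast+
qed

lemma tail_corner_in_crossing:
  assumes "c \<in> crossings D"
  shows "tail_corner D c \<in> c" and "c = orbit (rot D) (tail_corner D c)" and "tail_corner D c \<in> darts D"
proof -
  obtain d where d: "d \<in> darts D" "c = orbit (rot D) d" using assms unfolding crossings_def by blast
  obtain a where a: "a \<in> orbit (rot D) d" "a \<in> incoming D" "rot D a \<in> incoming D"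
    using coherent_incoming_exists[OF d(1)] .
  have c: "c = orbit (rot D) a" using crossing_eqI[OF a(1)] d by simp
  have da: "a \<in> darts D" using a(2) by (rule incoming_dart)
  have "tail_corner D c \<in> {a, rot D a, rot D (rot D a), rot D (rot D (rot D a))}"
    unfolding c tail_corner_eq(1)[OF a(2,3)] by simp
  then show "tail_corner D c \<in> c"
    unfolding crossing_eq[OF da, symmetric] c[symmetric] .
  then show "c = orbit (rot D) (tail_corner D c)" and "tail_corner D c \<in> darts D"
    using crossing_eqI[of "tail_corner D c" a] crossing_subset[OF da] c by blast+
qed

lemma coherent_tail_corner: "c \<in> crossings D \<Longrightarrow> coherent_corner D (tail_corner D c)"
  using tail_corner_iff(1)[of "tail_corner D c"] tail_corner_in_crossing[of c] by simp

lemma over_opp_rot: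
  assumes "alternating_diagram D" "d \<in> darts D"
  shows "opp D (rot D d) \<in> over D \<longleftrightarrow> d \<in> over D"
  using assms over_rot[OF assms(2)] unfolding alternating_diagram_def by (metis rot_in_darts)

lemma incoming_opp_rot:
  assumes "coherent_corner D d" "d \<in> darts D"
  shows "opp D (rot D d) \<in> incoming D \<longleftrightarrow> d \<notin> incoming D"
  using assms by (simp add: coherent_corner_def incoming_opp)

lemma tait_graph_simps:
  "verts (tait_graph D) = unshaded_regions D" "arcs (tait_graph D) = crossings D"
  "tail (tait_graph D) c = region_at D (tail_corner D c)"
  "head (tait_graph D) c = region_at D (rot D (rot D (tail_corner D c)))"
  by (simp_all add: tait_graph_def)

text \<open>
  The edges leaving and entering \<open>R\<close> correspond to the tail corners \<open>T\<close> and the head corners \<open>H\<close> in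
  \<open>R\<close>, and passing to the next corner of \<open>R\<close> exchanges \<open>T\<close> and \<open>H\<close>.
\<close>

lemma tait_graph_balanced:
  assumes special: "special_diagram D" and alt: "alternating_diagram D"
  shows "card (out_arcs (tait_graph D) R) = card (in_arcs (tait_graph D) R)"
proof (cases "R \<in> regions D")
  case False
  then have "out_arcs (tait_graph D) R = {}" "in_arcs (tait_graph D) R = {}"
    unfolding out_arcs_def in_arcs_def tait_graph_simps using tail_corner_in_crossing(3) by auto
  then show ?thesis by simp
next
  case True
  then obtain r where r: "r \<in> darts D" "R = region_at D r" unfolding regions_def by blast
  have R: "region_at D x = R \<longleftrightarrow> x \<in> R" for x
    using region_self region_eqI r(2) by blast
  have Rd: "x \<in> darts D" if "x \<in> R" for x using that r region_subset by blast
  define T where "T = {x \<in> R. coherent_corner D x \<and> (x \<in> incoming D \<longleftrightarrow> x \<in> over D)}"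
  define H where "H = {x \<in> R. coherent_corner D x \<and> (x \<in> incoming D \<longleftrightarrow> x \<notin> over D)}"
  have fin: "finite R" using r region_subset finite_darts finite_subset by metis
  have "bij_betw (tail_corner D) (out_arcs (tait_graph D) R) T"
  proof (rule bij_betw_byWitness[where f' = "orbit (rot D)"])
    show "\<forall>c\<in>out_arcs (tait_graph D) R. orbit (rot D) (tail_corner D c) = c"
      unfolding out_arcs_def tait_graph_simps using tail_corner_in_crossing(2) by simp
    show "\<forall>x\<in>T. tail_corner D (orbit (rot D) x) = x"
      using tail_corner_iff(1) Rd unfolding T_def by blast
    show "tail_corner D ` out_arcs (tait_graph D) R \<subseteq> T"
    proof
      fix x assume "x \<in> tail_corner D ` out_arcs (tait_graph D) R"
      then obtain c where c: "c \<in> crossings D" "x = tail_corner D c" "x \<in> R"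
        unfolding out_arcs_def tait_graph_simps using R by blast
      then show "x \<in> T"
        using tail_corner_iff(1)[OF Rd[OF c(3)]] tail_corner_in_crossing(2)[OF c(1)]
        unfolding T_def by simp
    qed
    show "orbit (rot D) ` T \<subseteq> out_arcs (tait_graph D) R"
    proof
      fix c assume "c \<in> orbit (rot D) ` T"
      then obtain x where x: "x \<in> T" "c = orbit (rot D) x" by blast
      then have "x \<in> R" "tail_corner D c = x"
        using tail_corner_iff(1) Rd unfolding T_def by auto
      then show "c \<in> out_arcs (tait_graph D) R"
        unfolding out_arcs_def tait_graph_simps using x Rd R by (simp add: crossings_def)
    qed
  qed
  then have out: "card (out_arcs (tait_graph D) R) = card T" by (rule bij_betw_same_card)
  have "bij_betw (\<lambda>c. rot D (rot D (tail_corner D c))) (in_arcs (tait_graph D) R) H"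
  proof (rule bij_betw_byWitness[where f' = "orbit (rot D)"])
    show "\<forall>c\<in>in_arcs (tait_graph D) R. orbit (rot D) (rot D (rot D (tail_corner D c))) = c"
      unfolding in_arcs_def tait_graph_simps using tail_corner_in_crossing(2) by simp
    show "\<forall>x\<in>H. rot D (rot D (tail_corner D (orbit (rot D) x))) = x"
      using tail_corner_iff(2) Rd unfolding H_def by blast
    show "(\<lambda>c. rot D (rot D (tail_corner D c))) ` in_arcs (tait_graph D) R \<subseteq> H"
    proof
      fix x assume "x \<in> (\<lambda>c. rot D (rot D (tail_corner D c))) ` in_arcs (tait_graph D) R"
      then obtain c where c: "c \<in> crossings D" "x = rot D (rot D (tail_corner D c))" "x \<in> R"
        unfolding in_arcs_def tait_graph_simps using R by blast
      have "orbit (rot D) x = c" using c tail_corner_in_crossing(2)[OF c(1)] by simp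
      then show "x \<in> H"
        using tail_corner_iff(2)[OF Rd[OF c(3)]] c unfolding H_def by simp
    qed
    show "orbit (rot D) ` H \<subseteq> in_arcs (tait_graph D) R"
    proof
      fix c assume "c \<in> orbit (rot D) ` H"
      then obtain x where x: "x \<in> H" "c = orbit (rot D) x" by blast
      then have "x \<in> R" "rot D (rot D (tail_corner D c)) = x"
        using tail_corner_iff(2) Rd unfolding H_def by auto
      then show "c \<in> in_arcs (tait_graph D) R"
        unfolding in_arcs_def tait_graph_simps using x Rd R by (simp add: crossings_def)
    qed
  qed
  then have inn: "card (in_arcs (tait_graph D) R) = card H" by (rule bij_betw_same_card)
  let ?\<phi> = "\<lambda>x. opp D (rot D x)"
  have inj: "inj_on ?\<phi> X" for X
    using permutes_inj[OF region_permutes] by (auto simp: inj_on_def)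
  have "?\<phi> x \<in> R" if "x \<in> R" for x using that region_step r by blast
  then have "?\<phi> ` T \<subseteq> H" "?\<phi> ` H \<subseteq> T"
    using Rd unfolding T_def H_def
    by (auto simp: coherent_opp_rot[OF special] over_opp_rot[OF alt] incoming_opp_rot)
  then have "card T \<le> card H" "card H \<le> card T"
    using fin by (auto intro!: card_inj_on_le[OF inj] simp: T_def H_def)
  then show ?thesis using out inn by simp
qed

lemma positive_crossing_constant:
  assumes special: "special_diagram D" and alt: "alternating_diagram D"
    and c: "c \<in> crossings D" and c': "c' \<in> crossings D"
  shows "positive_crossing D c \<longleftrightarrow> positive_crossing D c'"
proof -
  have step: "positive_crossing D (orbit (rot D) (opp D (rot D x))) \<longleftrightarrow> positive_crossing D (orbit (rot D) x)"
    if x: "x \<in> darts D" and coh: "coherent_corner D x" for x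
  proof -
    have "coherent_corner D (opp D (rot D x))" using coherent_opp_rot[OF special x] coh by simp
    then show ?thesis
      using tail_corner_iff(3)[OF x coh] tail_corner_iff(3)[of "opp D (rot D x)"]
        over_opp_rot[OF alt x] x by simp
  qed
  \<comment> \<open>One of the two corners at \<open>x\<close> beside the arc from \<open>x\<close> to \<open>opp x\<close> is coherent, and \<open>step\<close> applies
    to the side of the arc on which it lies.\<close>
  have opp: "positive_crossing D (orbit (rot D) (opp D x)) \<longleftrightarrow> positive_crossing D (orbit (rot D) x)"
    if x: "x \<in> darts D" for x
  proof (cases "coherent_corner D x")
    case True
    define y where "y = rot D (rot D (rot D (opp D x)))"
    have y: "y \<in> darts D" "opp D (rot D y) = x" "orbit (rot D) y = orbit (rot D) (opp D x)"
      using x by (simp_all add: y_def rot4 opp_opp)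
    have "coherent_corner D y" using coherent_opp_rot[OF special y(1)] y(2) True by simp
    from step[OF y(1) this] show ?thesis using y by simp
  next
    case False
    define y where "y = rot D (rot D (rot D x))"
    have y: "y \<in> darts D" "opp D (rot D y) = opp D x" "orbit (rot D) y = orbit (rot D) x"
      using x by (simp_all add: y_def rot4)
    have "coherent_corner D y" using False x coherent_rot coherent_rot2 by (simp add: y_def)
    from step[OF y(1) this] show ?thesis using y by simp
  qed
  obtain d d' where d: "d \<in> darts D" "c = orbit (rot D) d" and d': "d' \<in> darts D" "c' = orbit (rot D) d'"
    using c c' unfolding crossings_def by blast
  have "positive_crossing D (orbit (rot D) d) \<longleftrightarrow> positive_crossing D c'"
    by (rule dart_induct[OF d'(1) _ _ _ d(1)]) (simp_all add: d' opp)
  then show ?thesis using d by simp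
qed

lemma common_weight_eq:
  assumes "special_diagram D" and "alternating_diagram D" and "c \<in> crossings D"
  shows "common_weight D = tait_weight D c"
  unfolding common_weight_def tait_graph_simps
proof (rule the_equality)
  show "\<forall>e\<in>crossings D. tait_weight D e = tait_weight D c"
    using positive_crossing_constant[OF assms(1,2) _ assms(3)] by (simp add: tait_weight_def)
qed (use assms(3) in auto)

end

section \<open>Edge resistances\<close>

theorem mainTheorem3:
  fixes D :: "'d diagram" and v :: "nat \<Rightarrow> 'd set"
    and \<Gamma> :: "('d set, 'd set) pre_digraph" and L L_hat :: "real mat"
    and \<omega> :: real and \<rho> r :: "'d set \<Rightarrow> real"
  assumes "connected_link_diagram D"
    and "special_diagram D"
    and "reduced_diagram D"
    and "alternating_diagram D"
    and "\<Gamma> = tait_graph D"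
    and "vertex_enumeration \<Gamma> v"
    and "L = tait_laplacian D v"
    and "\<omega> = common_weight D"
    and "L_hat = \<omega> \<cdot>\<^sub>m L"
    and "\<rho> = edge_resistance \<Gamma> v L_hat"
    and "r = edge_resistance \<Gamma> v L"
  shows "FP D v = 1 / 2 * (\<Sum>e\<in>arcs \<Gamma>. \<rho> e) \<and>
         FP D v = \<omega> / 2 * (\<Sum>e\<in>arcs \<Gamma>. r e)"
proof -
  interpret link_diagram D by unfold_locales (rule assms(1))
  note special = assms(2) and alt = assms(4)
  note \<Gamma> = tait_graph_simps[folded assms(5)]
  have weight: "tait_weight D c = \<omega>" if "c \<in> crossings D" for c
    using common_weight_eq[OF special alt that] assms(8) by simp
  obtain c\<^sub>0 where "c\<^sub>0 \<in> crossings D" using darts_nonempty unfolding crossings_def by blast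
  from weight[OF this] have \<omega>: "\<omega> = 1 \<or> \<omega> = -1" by (auto simp: tait_weight_def split: if_splits)
  have tail: "tail \<Gamma> c \<in> verts \<Gamma>" and head: "head \<Gamma> c \<in> verts \<Gamma>" and loop: "tail \<Gamma> c \<noteq> head \<Gamma> c"
    if c: "c \<in> crossings D" for c
  proof -
    have d: "tail_corner D c \<in> darts D" and coh: "coherent_corner D (tail_corner D c)"
      using tail_corner_in_crossing(3)[OF c] coherent_tail_corner[OF c] .
    show "tail \<Gamma> c \<in> verts \<Gamma>"
      unfolding \<Gamma> using coherent_iff_unshaded[OF special d] coh by simp
    show "head \<Gamma> c \<in> verts \<Gamma>"
      unfolding \<Gamma> using coherent_iff_unshaded[OF special, of "rot D (rot D (tail_corner D c))"]
        coherent_rot2[OF d] coh d by simp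
    show "tail \<Gamma> c \<noteq> head \<Gamma> c"
      unfolding \<Gamma> using assms(3) c tail_corner_in_crossing(1)[OF c]
      unfolding reduced_diagram_def nugatory_def by blast
  qed
  have balanced: "(\<Sum>e\<in>out_arcs \<Gamma> x. tait_weight D e) = (\<Sum>e\<in>in_arcs \<Gamma> x. tait_weight D e)" for x
  proof -
    have "(\<Sum>e\<in>out_arcs \<Gamma> x. tait_weight D e) = (\<Sum>e\<in>out_arcs \<Gamma> x. \<omega>)"
      by (rule sum.cong) (auto simp: out_arcs_def \<Gamma> weight)
    moreover have "(\<Sum>e\<in>in_arcs \<Gamma> x. tait_weight D e) = (\<Sum>e\<in>in_arcs \<Gamma> x. \<omega>)"
      by (rule sum.cong) (auto simp: in_arcs_def \<Gamma> weight)
    ultimately show ?thesis using tait_graph_balanced[OF special alt, of x] by (simp add: assms(5))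
  qed
  define X where "X = pseudoinverse L"
  have L: "L \<in> carrier_mat (card (verts \<Gamma>)) (card (verts \<Gamma>))"
    by (simp add: assms(5,7) tait_laplacian_def laplacian_def)
  have X: "X \<in> carrier_mat (card (verts \<Gamma>)) (card (verts \<Gamma>))"
    using is_pseudoinverse_pseudoinverse[of L] L by (simp add: is_pseudoinverse_def X_def)
  have "FP D v = 1 / 2 * (\<Sum>e\<in>arcs \<Gamma>. tait_weight D e * r e)"
    unfolding FP_def assms(11) edge_resistance_def Let_def assms(7)[symmetric] X_def[symmetric]
    unfolding assms(7) tait_laplacian_def assms(5)[symmetric]
    by (rule trace_laplacian_transpose_mult[OF assms(6)])
      (use finite_crossings tail head loop balanced X in \<open>simp_all add: \<Gamma>(2)\<close>)
  also have "(\<Sum>e\<in>arcs \<Gamma>. tait_weight D e * r e) = \<omega> * (\<Sum>e\<in>arcs \<Gamma>. r e)"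
    unfolding sum_distrib_left \<Gamma>(2) by (rule sum.cong) (simp_all add: weight)
  finally have r: "FP D v = \<omega> / 2 * (\<Sum>e\<in>arcs \<Gamma>. r e)" by simp
  have X_hat: "pseudoinverse L_hat = \<omega> \<cdot>\<^sub>m X"
    using pseudoinverse_smult[of \<omega> L] \<omega> by (auto simp: assms(9) X_def)
  have idx: "vertex_index \<Gamma> v x < card (verts \<Gamma>)" if "x \<in> verts \<Gamma>" for x
    using bij_betw_inv_into assms(6) that
    unfolding vertex_enumeration_def vertex_index_def by (metis bij_betwE lessThan_iff)
  have "\<rho> e = \<omega> * r e" if "e \<in> arcs \<Gamma>" for e
    using idx[OF tail] idx[OF head] that X
    unfolding assms(10,11) edge_resistance_def Let_def X_hat X_def[symmetric]
    by (simp add: \<Gamma>(2) algebra_simps)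
  then have "(\<Sum>e\<in>arcs \<Gamma>. \<rho> e) = \<omega> * (\<Sum>e\<in>arcs \<Gamma>. r e)"
    unfolding sum_distrib_left by (rule sum.cong[OF refl])
  with r show ?thesis by simp
qed

end
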